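(* Suppose that every $f_i$, $i\in[n]$, is differentiable with $\|\nabla f_i(x)-\nabla f_i(y)\|\le L\|x-y\|$ for all $x,y\in\mathbb{R}^d$ (for some constant $L>0$), and that $h$ is convex and proximable. Let $m>1$, let $(\beta_\tau)_{\tau\in\mathbb{N}}$ satisfy $\beta_\tau>0$ for every $\tau\in\mathbb{N}$, let $$0<\gamma<\min\left(\frac{1}{4L},\ \frac{\sqrt{\ell b}}{\sqrt{32(e-1)d}\,L\,m}\right),$$ where $e$ is Euler's (Napier's) constant, and set $\Delta:=\frac12-L\gamma$. Let $(x_k^\tau)$, $0\le k\le m-1$, $\tau\ge 0$, be generated by Algorithm VR-SZD. Then $$\eta_m^T\ \le\ \frac{F(x_0^0)-\min F}{\Delta\gamma m(T+1)}+\left(\frac{3d}{\ell b}+2+3d\right)\frac{L^2d}{\Delta(T+1)}\sum_{\tau=0}^{T}\beta_\tau^2 .$$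
   Context: Problem: minimize over $x\in\mathbb{R}^d$ the function $F(x):=f(x)+h(x)$ with $f(x):=\frac1n\sum_{i=1}^n f_i(x)$, where $f_i:\mathbb{R}^d\to\mathbb{R}$ are differentiable (possibly non-convex) and $h:\mathbb{R}^d\to\mathbb{R}\cup\{+\infty\}$ is convex, possibly non-differentiable, and proximable, meaning that for all $x\in\mathbb{R}^d$, $\gamma>0$ the point $\mathrm{prox}_{\gamma h}(x):=\arg\min_y\{h(y)+\frac{1}{2\gamma}\|y-x\|^2\}$ is well defined (and computable). $\min F$ denotes the minimum value of $F$, assumed to exist. $[n]=\{1,\dots,n\}$, $(e_j)_{j=1}^d$ is the canonical basis of $\mathbb{R}^d$, and $O(d)$ is the group of orthogonal $d\times d$ matrices; "uniformly from $O(d)$" means according to the normalized Haar measure. Finite-difference surrogates: for $\beta>0$, $g(x,\beta):=\sum_{j=1}^d\frac{f(x+\beta e_j)-f(x)}{\beta}e_j$; for $i\in[n]$, $G\in O(d)$, $\hat g_i(x,G,\beta):=\frac{d}{\ell}\sum_{j=1}^\ell\frac{f_i(x+\beta Ge_j)-f_i(x)}{\beta}Ge_j$. Algorithm VR-SZD. Input: $x_0^0\in\mathbb{R}^d$, $T,m\in\mathbb{N}_+$, stepsize $\gamma>0$, $(\beta_\tau)_{\tau\in\mathbb{N}}\subset(0,\infty)$, an integer $1\le\ell\le d$, and a batch size $b\in\mathbb{N}_+$. For $\tau=0,\dots,T$: for $k=0,\dots,m-1$, sample $i_{1,k}^\tau,\dots,i_{b,k}^\tau$ uniformly from $[n]$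 with replacement and $G_{1,k}^\tau,\dots,G_{b,k}^\tau$ uniformly from $O(d)$ (all independent of each other and of the past), and set $$v_k^\tau=\frac1b\sum_{j=1}^b\Big(\hat g_{i_{j,k}^\tau}(x_k^\tau,G_{j,k}^\tau,\beta_\tau)-\hat g_{i_{j,k}^\tau}(x_0^\tau,G_{j,k}^\tau,\beta_\tau)\Big)+g(x_0^\tau,\beta_\tau),\qquad x_{k+1}^\tau=\mathrm{prox}_{\gamma h}(x_k^\tau-\gamma v_k^\tau);$$ then set $x_0^{\tau+1}=x_m^\tau$. Gradient mapping: $\mathcal{G}_\gamma(x):=\frac1\gamma\big(x-\mathrm{prox}_{\gamma h}(x-\gamma\nabla f(x))\big)$. Convergence measure: $\eta_m^T:=\frac{1}{(T+1)m}\sum_{\tau=0}^T\sum_{k=0}^{m-1}\mathbb{E}\big[\|\mathcal{G}_\gamma(x_k^\tau)\|^2\big]$. *)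

theory Defs
  imports "HOL-Probability.Probability"
begin

definition finite_sum :: "nat \<Rightarrow> (nat \<Rightarrow> 'a \<Rightarrow> real) \<Rightarrow> 'a \<Rightarrow> real" where
  "finite_sum n fs x = (1 / real n) * (\<Sum>i = 1..n. fs i x)"

definition objective :: "nat \<Rightarrow> (nat \<Rightarrow> 'a \<Rightarrow> real) \<Rightarrow> ('a \<Rightarrow> ereal) \<Rightarrow> 'a \<Rightarrow> ereal" where
  "objective n fs h x = ereal (finite_sum n fs x) + h x"

definition gradient :: "('a::real_inner \<Rightarrow> real) \<Rightarrow> 'a \<Rightarrow> 'a" where
  "gradient f x = (THE D. GDERIV f x :> D)"

text \<open>Convexity for functions with values in the reals extended by plus infinity. The library
  predicate \<open>convex_on\<close> only covers real-valued functions. The convention \<open>0 * \<infinity> = 0\<close> of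
  \<^typ>\<open>ereal\<close> makes the inequality trivial at \<open>t = 0\<close> and \<open>t = 1\<close>.\<close>

definition convex_ext :: "('a::real_vector \<Rightarrow> ereal) \<Rightarrow> bool" where
  "convex_ext h \<longleftrightarrow> (\<forall>x. h x \<noteq> -\<infinity>) \<and>
     (\<forall>x y. \<forall>t\<in>{0..1}.
        h ((1 - t) *\<^sub>R x + t *\<^sub>R y) \<le> ereal (1 - t) * h x + ereal t * h y)"

definition prox_objective :: "real \<Rightarrow> ('a::real_normed_vector \<Rightarrow> ereal) \<Rightarrow> 'a \<Rightarrow> 'a \<Rightarrow> ereal" where
  "prox_objective \<gamma> h x y = h y + ereal (1 / (2 * \<gamma>) * (norm (y - x))\<^sup>2)"

definition prox :: "real \<Rightarrow> ('a::real_normed_vector \<Rightarrow> ereal) \<Rightarrow> 'a \<Rightarrow> 'a" where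
  "prox \<gamma> h x = arg_min (prox_objective \<gamma> h x) (\<lambda>_. True)"

text \<open>Well-definedness of the proximal point is existence and uniqueness of the minimizer. This
  excludes \<open>h\<close> being constantly \<open>\<infinity>\<close> on a nontrivial space, since then every point is a minimizer.\<close>

definition proximable :: "('a::real_normed_vector \<Rightarrow> ereal) \<Rightarrow> bool" where
  "proximable h \<longleftrightarrow>
     (\<forall>x. \<forall>\<gamma>>0. \<exists>!y. is_arg_min (prox_objective \<gamma> h x) (\<lambda>_. True) y)"

definition gradient_mapping ::
    "real \<Rightarrow> ('a::real_inner \<Rightarrow> real) \<Rightarrow> ('a \<Rightarrow> ereal) \<Rightarrow> 'a \<Rightarrow> 'a" where
  "gradient_mapping \<gamma> f h x = (1 / \<gamma>) *\<^sub>R (x - prox \<gamma> h (x - \<gamma> *\<^sub>R gradient f x))"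

text \<open>The index type \<open>'d\<close> carries no order, whereas the structured surrogate uses the first \<open>l\<close>
  basis vectors. The canonical basis is therefore listed along an enumeration
  \<open>enum\<close> of \<open>'d\<close> by \<open>1, \<dots>, CARD('d)\<close>.\<close>

definition basis_vec :: "(nat \<Rightarrow> 'd::finite) \<Rightarrow> nat \<Rightarrow> real ^ 'd" where
  "basis_vec enum j = axis (enum j) 1"

definition full_fd ::
    "(nat \<Rightarrow> 'd::finite) \<Rightarrow> (real ^ 'd \<Rightarrow> real) \<Rightarrow> real ^ 'd \<Rightarrow> real \<Rightarrow> real ^ 'd" where
  "full_fd enum f x \<beta> =
     (\<Sum>j = 1..CARD('d). ((f (x + \<beta> *\<^sub>R basis_vec enum j) - f x) / \<beta>) *\<^sub>R basis_vec enum j)"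

definition structured_fd ::
    "(nat \<Rightarrow> 'd::finite) \<Rightarrow> nat \<Rightarrow> (real ^ 'd \<Rightarrow> real) \<Rightarrow> real ^ 'd \<Rightarrow> real ^ 'd ^ 'd \<Rightarrow> real \<Rightarrow> real ^ 'd"
  where
  "structured_fd enum l f x G \<beta> =
     (real CARD('d) / real l) *\<^sub>R
       (\<Sum>j = 1..l. ((f (x + \<beta> *\<^sub>R (G *v basis_vec enum j)) - f x) / \<beta>) *\<^sub>R (G *v basis_vec enum j))"

definition orthogonal_mats :: "(real ^ 'd ^ 'd) set" where
  "orthogonal_mats = {Q. orthogonal_matrix Q}"

abbreviation orthogonal_borel :: "(real ^ 'd ^ 'd) measure" where
  "orthogonal_borel \<equiv> restrict_space borel orthogonal_mats"

text \<open>The normalized Haar measure of the orthogonal group: its (unique) left-invariant Borel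
  probability measure. As the group is compact, it is also right-invariant.\<close>

definition is_normalized_haar :: "(real ^ 'd ^ 'd) measure \<Rightarrow> bool" where
  "is_normalized_haar \<mu> \<longleftrightarrow> prob_space \<mu> \<and> sets \<mu> = sets orthogonal_borel \<and>
     (\<forall>Q\<in>orthogonal_mats. distr \<mu> \<mu> (\<lambda>G. Q ** G) = \<mu>)"

text \<open>\<open>idx \<tau> k j\<close> and \<open>rot \<tau> k j\<close> are the component index and the orthogonal matrix drawn in outer
  iteration \<open>\<tau>\<close>, inner iteration \<open>k\<close>, batch position \<open>j\<close>. The product law says that the index is
  uniform, the matrix Haar distributed, and the two independent of each other. Together with the
  independence of the family of pairs this is mutual independence of all draws.\<close>

definition vr_szd_sampling ::
    "'w measure \<Rightarrow> nat \<Rightarrow> (real ^ 'd ^ 'd) measure \<Rightarrow> nat \<Rightarrow> nat \<Rightarrow> nat \<Rightarrow>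
     (nat \<Rightarrow> nat \<Rightarrow> nat \<Rightarrow> 'w \<Rightarrow> nat) \<Rightarrow> (nat \<Rightarrow> nat \<Rightarrow> nat \<Rightarrow> 'w \<Rightarrow> real ^ 'd ^ 'd) \<Rightarrow> bool" where
  "vr_szd_sampling M n \<mu> T m b idx rot \<longleftrightarrow>
     prob_space.indep_vars M (\<lambda>_. count_space {1..n} \<Otimes>\<^sub>M orthogonal_borel)
       (\<lambda>(\<tau>, k, j) \<omega>. (idx \<tau> k j \<omega>, rot \<tau> k j \<omega>)) ({0..T} \<times> {0..<m} \<times> {1..b}) \<and>
     (\<forall>\<tau>\<in>{0..T}. \<forall>k\<in>{0..<m}. \<forall>j\<in>{1..b}.
        distr M (count_space {1..n} \<Otimes>\<^sub>M orthogonal_borel) (\<lambda>\<omega>. (idx \<tau> k j \<omega>, rot \<tau> k j \<omega>))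
          = uniform_count_measure {1..n} \<Otimes>\<^sub>M \<mu>)"

text \<open>In the next two definitions \<open>ix\<close> and \<open>Gs\<close> (respectively \<open>ix \<tau> k\<close> and \<open>Gs \<tau> k\<close>) are realized samples.\<close>

definition vr_direction ::
    "(nat \<Rightarrow> 'd::finite) \<Rightarrow> nat \<Rightarrow> (nat \<Rightarrow> real ^ 'd \<Rightarrow> real) \<Rightarrow> nat \<Rightarrow> nat \<Rightarrow> real \<Rightarrow>
     (nat \<Rightarrow> nat) \<Rightarrow> (nat \<Rightarrow> real ^ 'd ^ 'd) \<Rightarrow> real ^ 'd \<Rightarrow> real ^ 'd \<Rightarrow> real ^ 'd" where
  "vr_direction enum n fs l b \<beta> ix Gs x x0 =
     (1 / real b) *\<^sub>R
       (\<Sum>j = 1..b. structured_fd enum l (fs (ix j)) x (Gs j) \<beta>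
                  - structured_fd enum l (fs (ix j)) x0 (Gs j) \<beta>)
     + full_fd enum (finite_sum n fs) x0 \<beta>"

text \<open>\<open>vr_szd \<dots> \<tau> k\<close> is the iterate of outer iteration \<open>\<tau>\<close> and inner iteration \<open>k\<close>.\<close>

fun vr_szd ::
    "(nat \<Rightarrow> 'd::finite) \<Rightarrow> nat \<Rightarrow> (nat \<Rightarrow> real ^ 'd \<Rightarrow> real) \<Rightarrow> (real ^ 'd \<Rightarrow> ereal) \<Rightarrow>
     nat \<Rightarrow> nat \<Rightarrow> nat \<Rightarrow> real \<Rightarrow> (nat \<Rightarrow> real) \<Rightarrow> real ^ 'd \<Rightarrow>
     (nat \<Rightarrow> nat \<Rightarrow> nat \<Rightarrow> nat) \<Rightarrow> (nat \<Rightarrow> nat \<Rightarrow> nat \<Rightarrow> real ^ 'd ^ 'd) \<Rightarrow>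
     nat \<Rightarrow> nat \<Rightarrow> real ^ 'd" where
  "vr_szd enum n fs h l b m \<gamma> \<beta> x00 ix Gs 0 0 = x00"
| "vr_szd enum n fs h l b m \<gamma> \<beta> x00 ix Gs (Suc \<tau>) 0 =
     vr_szd enum n fs h l b m \<gamma> \<beta> x00 ix Gs \<tau> m"
| "vr_szd enum n fs h l b m \<gamma> \<beta> x00 ix Gs \<tau> (Suc k) =
     prox \<gamma> h (vr_szd enum n fs h l b m \<gamma> \<beta> x00 ix Gs \<tau> k -
       \<gamma> *\<^sub>R vr_direction enum n fs l b (\<beta> \<tau>) (ix \<tau> k) (Gs \<tau> k)
              (vr_szd enum n fs h l b m \<gamma> \<beta> x00 ix Gs \<tau> k)
              (vr_szd enum n fs h l b m \<gamma> \<beta> x00 ix Gs \<tau> 0))"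

definition convergence_measure ::
    "'w measure \<Rightarrow> real \<Rightarrow> ('a::real_inner \<Rightarrow> real) \<Rightarrow> ('a \<Rightarrow> ereal) \<Rightarrow>
     (nat \<Rightarrow> nat \<Rightarrow> 'w \<Rightarrow> 'a) \<Rightarrow> nat \<Rightarrow> nat \<Rightarrow> real" where
  "convergence_measure M \<gamma> f h X T m =
     1 / (real (T + 1) * real m) *
       (\<Sum>\<tau> = 0..T. \<Sum>k = 0..<m.
          prob_space.expectation M (\<lambda>\<omega>. (norm (gradient_mapping \<gamma> f h (X \<tau> k \<omega>)))\<^sup>2))"

end

theory Submission
  imports Defs
begin

text \<open>Write \<open>f\<close> for the average of the \<open>f\<^sub>i\<close>, \<open>d\<close> for the dimension and
  \<open>P\<^sub>G v = (d / l) (\<langle>v, G e\<^sub>1\<rangle> G e\<^sub>1 + \<dots> + \<langle>v, G e\<^sub>l\<rangle> G e\<^sub>l)\<close> for the rescaled projection of \<open>v\<close>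
  onto the first \<open>l\<close> vectors of the frame \<open>G\<close> (\<open>sketch\<close> below).

  A structured finite difference of an \<open>L\<close>-smooth function \<open>u\<close> is \<open>P\<^sub>G\<close> applied to the gradient of
  \<open>u\<close>, up to a vector of norm at most \<open>d L \<beta> / 2\<close> for every orthogonal \<open>G\<close>
  (\<open>structured_fd_linearization\<close>). Consequently the error
  \<open>v - \<nabla>f(x)\<close> of the search direction at \<open>x\<close> with anchor \<open>x\<^sub>0\<close> is a discretization error of order
  \<open>d L \<beta>\<close> plus the mean \<open>A\<close> of \<open>b\<close> independent copies of
  \<open>P\<^sub>G (\<nabla>f\<^sub>i(x) - \<nabla>f\<^sub>i(x\<^sub>0)) - (\<nabla>f(x) - \<nabla>f(x\<^sub>0))\<close> (\<open>vr_direction_error\<close>). Invariance of the Haar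
  measure under sign changes and permutations of the coordinates gives
  \<open>\<bbbE> P\<^sub>G v = v\<close> and \<open>\<bbbE> \<parallel>P\<^sub>G v\<parallel>\<^sup>2 = (d / l) \<parallel>v\<parallel>\<^sup>2\<close>. So each copy has conditional mean zero given the
  past, the copies are conditionally uncorrelated, and
  \<open>\<bbbE> \<parallel>A\<parallel>\<^sup>2 \<le> c \<bbbE> \<parallel>x - x\<^sub>0\<parallel>\<^sup>2\<close> with \<open>c = d L\<^sup>2 / (l b)\<close> (\<open>expectation_noise_le\<close>).

  On the deterministic side, one inexact proximal gradient step from \<open>x\<close> to \<open>x'\<close> decreases
  \<open>F = f + h\<close> by \<open>(\<gamma> / 2) \<parallel>\<G>\<^sub>\<gamma>(x)\<parallel>\<^sup>2 + (1 / (2 \<gamma>) - L / 2) \<parallel>x' - x\<parallel>\<^sup>2\<close> up to the error term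
  \<open>(\<gamma> / 2) \<parallel>v - \<nabla>f(x)\<parallel>\<^sup>2\<close> (\<open>prox_gradient_descent\<close>). Over an epoch, the distances
  \<open>\<parallel>x\<^sub>k - x\<^sub>0\<parallel>\<^sup>2\<close> sum to at most \<open>m\<^sup>2 / 2\<close> times the sum of the \<open>\<parallel>x\<^sub>k\<^sub>+\<^sub>1 - x\<^sub>k\<parallel>\<^sup>2\<close>, and the bound on the
  stepsize makes \<open>\<gamma> c m\<^sup>2 / 2 \<le> 1 / (2 \<gamma>) - L / 2\<close>. Hence on every trajectory the movement of the
  iterates pays for \<open>\<gamma> c \<parallel>x\<^sub>k - x\<^sub>0\<parallel>\<^sup>2\<close>, and what remains of the noise is
  \<open>\<gamma> (\<parallel>A\<parallel>\<^sup>2 - c \<parallel>x\<^sub>k - x\<^sub>0\<parallel>\<^sup>2)\<close>, whose expectation is nonpositive (\<open>trajectory_descent\<close>,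
  \<open>expectation_gradient_mapping_le\<close>). Telescoping \<open>F\<close> over all steps gives the rate. All random
  variables involved are bounded, because the iterates are, so every expectation is finite.\<close>

section \<open>Functions with Lipschitz continuous gradient\<close>

definition smooth_with :: "real \<Rightarrow> ('a::euclidean_space \<Rightarrow> real) \<Rightarrow> bool" where
  "smooth_with L f \<longleftrightarrow> (\<forall>x. f differentiable (at x)) \<and>
     (\<forall>x y. norm (gradient f x - gradient f y) \<le> L * norm (x - y))"

lemma gradient_eqI:
  assumes "GDERIV f x :> D"
  shows "gradient f x = D"
  unfolding gradient_def
proof (rule the_equality)
  show "GDERIV f x :> D" by (rule assms)
next
  fix E assume "GDERIV f x :> E"
  then have "(\<lambda>h. inner h E) = (\<lambda>h. inner h D)"
    using assms has_derivative_unique unfolding gderiv_def by blast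
  then have "inner h (E - D) = 0" for h
    by (metis inner_diff_right right_minus_eq)
  then show "E = D"
    by (metis inner_eq_zero_iff right_minus_eq)
qed

lemma GDERIV_gradient:
  fixes f :: "'a::euclidean_space \<Rightarrow> real"
  assumes "f differentiable (at x)"
  shows "GDERIV f x :> gradient f x"
proof -
  obtain f' where f': "(f has_derivative f') (at x)"
    using assms by (auto simp: differentiable_def)
  interpret bounded_linear f' by (rule has_derivative_bounded_linear[OF f'])
  define D where "D = (\<Sum>b\<in>Basis. f' b *\<^sub>R b)"
  have f'_eq: "f' = (\<lambda>u. inner u D)"
  proof
    fix u
    have "f' u = f' (\<Sum>b\<in>Basis. inner u b *\<^sub>R b)" by (simp add: euclidean_representation)
    also have "\<dots> = (\<Sum>b\<in>Basis. inner u b * f' b)" by (simp add: sum scaleR)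
    finally show "f' u = inner u D" by (simp add: D_def inner_sum_right mult.commute)
  qed
  have "GDERIV f x :> D"
    using f' unfolding f'_eq gderiv_def .
  then show ?thesis by (simp add: gradient_eqI)
qed

lemma gradient_finite_sum:
  fixes fs :: "nat \<Rightarrow> 'a::euclidean_space \<Rightarrow> real"
  assumes "\<And>i. i \<in> {1..n} \<Longrightarrow> fs i differentiable (at x)"
  shows "finite_sum n fs differentiable (at x)"
    and "gradient (finite_sum n fs) x = (1 / real n) *\<^sub>R (\<Sum>i = 1..n. gradient (fs i) x)"
proof -
  have *: "GDERIV (finite_sum n fs) x :> (1 / real n) *\<^sub>R (\<Sum>i = 1..n. gradient (fs i) x)"
    unfolding gderiv_def finite_sum_def inner_scaleR_right inner_sum_right
    using GDERIV_gradient[OF assms] unfolding gderiv_def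
    by (intro has_derivative_mult_right has_derivative_sum) auto
  then show "finite_sum n fs differentiable (at x)"
    by (auto simp: gderiv_def differentiable_def)
  show "gradient (finite_sum n fs) x = (1 / real n) *\<^sub>R (\<Sum>i = 1..n. gradient (fs i) x)"
    using * by (rule gradient_eqI)
qed

lemma smooth_with_finite_sum:
  fixes fs :: "nat \<Rightarrow> 'a::euclidean_space \<Rightarrow> real"
  assumes "n \<ge> 1" and fs: "\<And>i. i \<in> {1..n} \<Longrightarrow> smooth_with L (fs i)"
  shows "smooth_with L (finite_sum n fs)"
  unfolding smooth_with_def
proof (intro conjI allI)
  have diff: "fs i differentiable (at x)" if "i \<in> {1..n}" for i x
    using fs[OF that] by (simp add: smooth_with_def)
  show "finite_sum n fs differentiable (at x)" for x
    using gradient_finite_sum(1) diff by blast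
  have grad: "gradient (finite_sum n fs) x = (1 / real n) *\<^sub>R (\<Sum>i = 1..n. gradient (fs i) x)" for x
    by (intro gradient_finite_sum(2) diff)
  fix x y
  have "norm (gradient (finite_sum n fs) x - gradient (finite_sum n fs) y)
      = 1 / real n * norm (\<Sum>i = 1..n. gradient (fs i) x - gradient (fs i) y)"
    by (simp only: grad sum_subtractf norm_scaleR flip: scaleR_diff_right) simp
  also have "\<dots> \<le> 1 / real n * (\<Sum>i = 1..n. L * norm (x - y))"
    using fs by (intro mult_left_mono sum_norm_le) (auto simp: smooth_with_def)
  also have "\<dots> = L * norm (x - y)" using \<open>n \<ge> 1\<close> by simp
  finally show "norm (gradient (finite_sum n fs) x - gradient (finite_sum n fs) y) \<le> L * norm (x - y)" .
qed

lemma smooth_with_uminus: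
  fixes f :: "'a::euclidean_space \<Rightarrow> real"
  assumes "smooth_with L f"
  shows "gradient (\<lambda>x. - f x) x = - gradient f x" and "smooth_with L (\<lambda>x. - f x)"
proof -
  have f: "f differentiable (at x)" for x using assms by (simp add: smooth_with_def)
  have *: "gradient (\<lambda>x. - f x) x = - gradient f x" for x
    by (rule gradient_eqI[OF GDERIV_minus[OF GDERIV_gradient[OF f]]])
  show "gradient (\<lambda>x. - f x) x = - gradient f x" by (rule *)
  show "smooth_with L (\<lambda>x. - f x)"
    using assms unfolding smooth_with_def *
    by (auto simp: norm_minus_commute intro: differentiable_minus)
qed

text \<open>Along the segment from \<open>x\<close> to \<open>y\<close> the defect, corrected by the quadratic, has nonpositive
  derivative.\<close>

lemma descent_inequality:
  fixes f :: "'a::euclidean_space \<Rightarrow> real"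
  assumes "smooth_with L f"
  shows "f y \<le> f x + inner (gradient f x) (y - x) + L / 2 * (norm (y - x))\<^sup>2"
proof -
  define u where "u = y - x"
  define \<phi> where "\<phi> t = f (x + t *\<^sub>R u) - t * inner (gradient f x) u - L / 2 * t\<^sup>2 * (norm u)\<^sup>2" for t
  have "\<phi> 1 \<le> \<phi> 0"
  proof (rule DERIV_nonpos_imp_nonincreasing[OF zero_le_one])
    fix t :: real assume t: "0 \<le> t" "t \<le> 1"
    define D where "D = inner u (gradient f (x + t *\<^sub>R u)) - inner (gradient f x) u - L * t * (norm u)\<^sup>2"
    have "GDERIV f (x + t *\<^sub>R u) :> gradient f (x + t *\<^sub>R u)"
      using assms by (intro GDERIV_gradient) (simp add: smooth_with_def)
    then have f': "(f has_derivative (\<lambda>h. inner h (gradient f (x + t *\<^sub>R u)))) (at (x + t *\<^sub>R u))"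
      by (simp add: gderiv_def)
    have "((\<lambda>t. f (x + t *\<^sub>R u)) has_derivative (\<lambda>s. inner (s *\<^sub>R u) (gradient f (x + t *\<^sub>R u)))) (at t)"
      by (rule has_derivative_compose[where f="\<lambda>t. x + t *\<^sub>R u" and f'="\<lambda>s. s *\<^sub>R u", OF _ f'])
         (auto intro!: derivative_eq_intros)
    then have "((\<lambda>t. f (x + t *\<^sub>R u)) has_real_derivative inner u (gradient f (x + t *\<^sub>R u))) (at t)"
      by (simp add: has_field_derivative_def mult_commute_abs)
    then have "(\<phi> has_real_derivative D) (at t)"
      unfolding \<phi>_def D_def by (auto intro!: derivative_eq_intros)
    moreover have "D \<le> 0"
    proof -
      have "inner u (gradient f (x + t *\<^sub>R u)) - inner (gradient f x) u
          = inner u (gradient f (x + t *\<^sub>R u) - gradient f x)"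
        by (simp add: inner_diff_right inner_commute)
      also have "\<dots> \<le> norm u * norm (gradient f (x + t *\<^sub>R u) - gradient f x)"
        by (rule norm_cauchy_schwarz)
      also have "\<dots> \<le> norm u * (L * norm ((x + t *\<^sub>R u) - x))"
        using assms by (intro mult_left_mono) (auto simp only: smooth_with_def norm_ge_zero)
      also have "\<dots> = L * t * (norm u)\<^sup>2" using t by (simp add: power2_eq_square)
      finally show ?thesis by (simp add: D_def)
    qed
    ultimately show "\<exists>y. DERIV \<phi> t :> y \<and> y \<le> 0" by blast
  qed
  then show ?thesis by (simp add: \<phi>_def u_def)
qed

lemma linearization_error:
  fixes f :: "'a::euclidean_space \<Rightarrow> real"
  assumes "smooth_with L f"
  shows "\<bar>f y - f x - inner (gradient f x) (y - x)\<bar> \<le> L / 2 * (norm (y - x))\<^sup>2"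
  using descent_inequality[OF assms, of y x]
    descent_inequality[OF smooth_with_uminus(2)[OF assms], of y x]
  unfolding smooth_with_uminus(1)[OF assms] abs_le_iff inner_minus_left by linarith

lemma smooth_with_continuous:
  fixes f :: "'a::euclidean_space \<Rightarrow> real"
  assumes "smooth_with L f"
  shows "continuous_on UNIV f" and "continuous_on UNIV (gradient f)"
proof -
  show "continuous_on UNIV f"
    using assms by (intro differentiable_imp_continuous_on)
      (auto simp: smooth_with_def differentiable_on_def)
  have "(\<bar>L\<bar>)-lipschitz_on UNIV (gradient f)"
  proof (rule lipschitz_onI)
    fix x y :: 'a
    have "norm (gradient f x - gradient f y) \<le> L * norm (x - y)"
      using assms by (simp add: smooth_with_def)
    also have "\<dots> \<le> \<bar>L\<bar> * norm (x - y)" by (intro mult_right_mono) auto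
    finally show "dist (gradient f x) (gradient f y) \<le> \<bar>L\<bar> * dist x y" by (simp add: dist_norm)
  qed simp
  then show "continuous_on UNIV (gradient f)" by (rule lipschitz_on_continuous_on)
qed

section \<open>The proximal step\<close>

context
  fixes h :: "'a::euclidean_space \<Rightarrow> ereal"
  assumes convex: "convex_ext h" and proximable: "proximable h"
begin

lemma prox_minimizes:
  assumes "\<gamma> > 0"
  shows "prox_objective \<gamma> h w (prox \<gamma> h w) \<le> prox_objective \<gamma> h w z"
proof -
  have "\<exists>y. is_arg_min (prox_objective \<gamma> h w) (\<lambda>_. True) y"
    using proximable assms unfolding proximable_def by blast
  then have "is_arg_min (prox_objective \<gamma> h w) (\<lambda>_. True) (prox \<gamma> h w)"
    unfolding prox_def arg_min_def by (rule someI_ex)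
  then show ?thesis by (simp add: is_arg_min_linorder)
qed

lemma proximable_proper: "\<exists>z. h z \<noteq> \<infinity>"
proof (rule ccontr)
  assume "\<nexists>z. h z \<noteq> \<infinity>"
  then have "is_arg_min (prox_objective 1 h 0) (\<lambda>_. True) z" for z
    by (simp add: is_arg_min_linorder prox_objective_def)
  then have unique: "z = z'" for z z' :: 'a
    using proximable unfolding proximable_def by (metis zero_less_one)
  obtain b :: 'a where "b \<in> Basis" using nonempty_Basis by blast
  then show False using unique[of b 0] nonzero_Basis by blast
qed

lemma prox_finite:
  assumes "\<gamma> > 0"
  shows "\<bar>h (prox \<gamma> h w)\<bar> \<noteq> \<infinity>"
proof -
  obtain z where z: "h z \<noteq> \<infinity>" using proximable_proper by blast
  have "h (prox \<gamma> h w) \<noteq> \<infinity>"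
  proof
    assume "h (prox \<gamma> h w) = \<infinity>"
    then show False
      using prox_minimizes[OF assms, of w z] z by (simp add: prox_objective_def)
  qed
  moreover have "h (prox \<gamma> h w) \<noteq> -\<infinity>" using convex by (simp add: convex_ext_def)
  ultimately show ?thesis by auto
qed

text \<open>Convexity and the comparison of the proximal point \<open>y\<close> with the points \<open>y + t (z - y)\<close> give the
  inequality up to an error of order \<open>t\<close>. It expresses that \<open>(w - y) / \<gamma>\<close> is a subgradient of \<open>h\<close>
  at \<open>y\<close>.\<close>

lemma prox_subgradient:
  assumes "\<gamma> > 0" and y: "y = prox \<gamma> h w" and z: "\<bar>h z\<bar> \<noteq> \<infinity>"
  shows "real_of_ereal (h y) + inner (w - y) (z - y) / \<gamma> \<le> real_of_ereal (h z)"
proof -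
  obtain hy where hy: "h y = ereal hy"
    using prox_finite[OF \<open>\<gamma> > 0\<close>, of w] unfolding y[symmetric] by (metis ereal_real')
  obtain hz where hz: "h z = ereal hz" using z by (metis ereal_real')
  have arith: "t * (hy + 2 * c * I - t * c * U) \<le> t * hz"
    if "hy + c * N \<le> (1 - t) * hy + t * hz + c * (N - 2 * t * I + t\<^sup>2 * U)" for c t N I U :: real
    using that by (simp add: algebra_simps power2_eq_square)
  (* Convexity bounds h at y + t (z - y); dividing by t leaves an error linear in t. *)
  have approx: "hy + inner (w - y) (z - y) / \<gamma> - t * (norm (z - y))\<^sup>2 / (2 * \<gamma>) \<le> hz"
    if t: "0 < t" "t \<le> 1" for t
  proof -
    have yz: "(1 - t) *\<^sub>R y + t *\<^sub>R z = y + t *\<^sub>R (z - y)" by (simp add: algebra_simps)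
    have "ereal (hy + 1 / (2 * \<gamma>) * (norm (y - w))\<^sup>2)
        \<le> prox_objective \<gamma> h w (y + t *\<^sub>R (z - y))"
      using prox_minimizes[OF \<open>\<gamma> > 0\<close>, of w "y + t *\<^sub>R (z - y)"] hy
      by (simp add: y prox_objective_def)
    also have "\<dots> \<le> (ereal (1 - t) * h y + ereal t * h z)
        + ereal (1 / (2 * \<gamma>) * (norm (y + t *\<^sub>R (z - y) - w))\<^sup>2)"
      using convex t unfolding prox_objective_def convex_ext_def yz[symmetric]
      by (intro add_right_mono) auto
    finally have "hy + 1 / (2 * \<gamma>) * (norm (y - w))\<^sup>2
        \<le> (1 - t) * hy + t * hz + 1 / (2 * \<gamma>) * (norm (y + t *\<^sub>R (z - y) - w))\<^sup>2"
      by (simp add: hy hz)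
    moreover have "(norm (y + t *\<^sub>R (z - y) - w))\<^sup>2
        = (norm (y - w))\<^sup>2 - 2 * t * inner (w - y) (z - y) + t\<^sup>2 * (norm (z - y))\<^sup>2"
    proof -
      define u v where "u = z - y" and "v = w - y"
      have "y + t *\<^sub>R (z - y) - w = t *\<^sub>R u - v" by (simp add: u_def v_def)
      moreover have "norm (y - w) = norm v" by (simp add: v_def norm_minus_commute)
      moreover have "(norm (t *\<^sub>R u - v))\<^sup>2 = (norm v)\<^sup>2 - 2 * t * inner v u + t\<^sup>2 * (norm u)\<^sup>2"
        unfolding power2_norm_eq_inner inner_diff_left inner_diff_right inner_commute[of u v]
        by (simp add: power2_eq_square inner_commute)
      ultimately show ?thesis by (simp only: u_def v_def)
    qed
    ultimately have "t * (hy + 2 * (1 / (2 * \<gamma>)) * inner (w - y) (z - y)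
        - t * (1 / (2 * \<gamma>)) * (norm (z - y))\<^sup>2) \<le> t * hz"
      by (intro arith) (simp only:)
    then have "t * (hy + inner (w - y) (z - y) / \<gamma> - t * (norm (z - y))\<^sup>2 / (2 * \<gamma>)) \<le> t * hz"
      by simp
    then show ?thesis using t by simp
  qed
  have "((\<lambda>t. hy + inner (w - y) (z - y) / \<gamma> - t * (norm (z - y))\<^sup>2 / (2 * \<gamma>))
      \<longlongrightarrow> hy + inner (w - y) (z - y) / \<gamma> - 0 * (norm (z - y))\<^sup>2 / (2 * \<gamma>)) (at_right 0)"
    by (intro tendsto_intros) (use \<open>\<gamma> > 0\<close> in auto)
  then have "hy + inner (w - y) (z - y) / \<gamma> - 0 * (norm (z - y))\<^sup>2 / (2 * \<gamma>) \<le> hz"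
    by (rule tendsto_upperbound)
       (auto simp: eventually_at_right_field intro!: exI[of _ 1] approx)
  then show ?thesis by (simp add: hy hz)
qed

text \<open>Adding the two subgradient inequalities, each tested at the other proximal point, is
  monotonicity of the subdifferential.\<close>

lemma prox_nonexpansive:
  assumes "\<gamma> > 0"
  shows "norm (prox \<gamma> h v - prox \<gamma> h w) \<le> norm (v - w)"
proof -
  define p q where "p = prox \<gamma> h v" and "q = prox \<gamma> h w"
  have "inner (v - p) (q - p) / \<gamma> + inner (w - q) (p - q) / \<gamma> \<le> 0"
    using prox_subgradient[OF assms p_def, of q] prox_subgradient[OF assms q_def, of p]
      prox_finite[OF assms, of v, folded p_def] prox_finite[OF assms, of w, folded q_def] by linarith
  then have "inner (v - p) (q - p) + inner (w - q) (p - q) \<le> 0"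
    using assms by (simp add: divide_le_0_iff flip: add_divide_distrib)
  moreover have "inner (v - p) (q - p) + inner (w - q) (p - q)
      = inner (p - q) (p - q) - inner (v - w) (p - q)"
    by (simp add: inner_diff_left inner_diff_right)
  ultimately have "(norm (p - q))\<^sup>2 \<le> inner (v - w) (p - q)"
    by (simp add: power2_norm_eq_inner)
  also have "\<dots> \<le> norm (v - w) * norm (p - q)" by (rule norm_cauchy_schwarz)
  finally have "norm (p - q) \<le> norm (v - w)"
    by (cases "p = q") (auto simp: power2_eq_square)
  then show ?thesis by (simp add: p_def q_def)
qed

lemma continuous_prox:
  assumes "\<gamma> > 0"
  shows "continuous_on UNIV (prox \<gamma> h)"
  by (rule lipschitz_on_continuous_on[of 1])
     (auto intro!: lipschitz_onI simp: dist_norm prox_nonexpansive[OF assms])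

end

section \<open>Finite differences along orthonormal frames\<close>

abbreviation frame :: "(nat \<Rightarrow> 'd::finite) \<Rightarrow> real ^ 'd ^ 'd \<Rightarrow> nat \<Rightarrow> real ^ 'd" where
  "frame enum G j \<equiv> G *v basis_vec enum j"

text \<open>The projection onto the first \<open>l\<close> frame vectors, scaled so that it is the identity in mean
  when \<open>G\<close> is Haar distributed.\<close>

definition sketch :: "(nat \<Rightarrow> 'd::finite) \<Rightarrow> nat \<Rightarrow> real ^ 'd ^ 'd \<Rightarrow> real ^ 'd \<Rightarrow> real ^ 'd" where
  "sketch enum l G v =
     (real CARD('d) / real l) *\<^sub>R (\<Sum>j = 1..l. inner v (frame enum G j) *\<^sub>R frame enum G j)"

lemma inner_frame:
  assumes "orthogonal_matrix G" "inj_on enum J" "i \<in> J" "j \<in> J"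
  shows "inner (frame enum G i) (frame enum G j) = (if i = j then 1 else 0)"
proof -
  have "orthogonal_transformation ((*v) G)"
    using assms(1) by (simp add: orthogonal_transformation_matrix)
  then have "inner (frame enum G i) (frame enum G j) = inner (basis_vec enum i) (basis_vec enum j)"
    by (simp add: orthogonal_transformation_def)
  then show ?thesis
    using assms(2-4) by (auto simp: basis_vec_def inner_axis_axis inj_on_eq_iff)
qed

lemma norm_frame:
  assumes "orthogonal_matrix G"
  shows "norm (frame enum G j) = 1"
  using inner_frame[OF assms, of enum "{j}" j j] by (simp add: norm_eq_1)

lemma norm_sum_frame:
  assumes "orthogonal_matrix G" "inj_on enum J" "finite J"
  shows "(norm (\<Sum>j\<in>J. c j *\<^sub>R frame enum G j))\<^sup>2 = (\<Sum>j\<in>J. (c j)\<^sup>2)"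
proof -
  have "(norm (\<Sum>j\<in>J. c j *\<^sub>R frame enum G j))\<^sup>2
      = (\<Sum>i\<in>J. c i * (\<Sum>j\<in>J. c j * inner (frame enum G j) (frame enum G i)))"
    by (simp add: power2_norm_eq_inner inner_sum_left inner_sum_right sum_distrib_left mult.assoc
        del: norm_eq_sqrt_inner)
  also have "\<dots> = (\<Sum>i\<in>J. c i * (\<Sum>j\<in>J. if i = j then c j else 0))"
    using inner_frame[OF assms(1,2)] by (intro sum.cong refl arg_cong2[where f="(*)"]) auto
  also have "\<dots> = (\<Sum>j\<in>J. (c j)\<^sup>2)"
    using assms(3) by (simp add: power2_eq_square)
  finally show ?thesis .
qed

text \<open>The unscaled sketch is an orthogonal projection \<open>Q\<close>, so this is \<open>\<parallel>Q v\<parallel>\<^sup>2 = \<langle>v, Q v\<rangle>\<close>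
  with the scaling put in. It reduces the second moment of the sketch to its first.\<close>

lemma norm_sketch_power2:
  fixes enum :: "nat \<Rightarrow> 'd::finite"
  assumes "orthogonal_matrix G" "inj_on enum {1..l}"
  shows "(norm (sketch enum l G v))\<^sup>2 = real CARD('d) / real l * inner v (sketch enum l G v)"
proof -
  have "(norm (sketch enum l G v))\<^sup>2
      = (real CARD('d) / real l)\<^sup>2 * (\<Sum>j = 1..l. (inner v (frame enum G j))\<^sup>2)"
    unfolding sketch_def norm_scaleR power_mult_distrib
    using norm_sum_frame[OF assms, of "\<lambda>j. inner v (frame enum G j)"] by simp
  then show ?thesis
    by (simp add: sketch_def inner_sum_right power2_eq_square)
qed

text \<open>Each difference quotient misses the directional derivative by at most \<open>L \<beta> / 2\<close>. These
  errors are coefficients along orthonormal vectors, so they add up in the Euclidean norm, which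
  saves a factor \<open>sqrt l\<close> over the triangle inequality.\<close>

lemma structured_fd_linearization:
  fixes enum :: "nat \<Rightarrow> 'd::finite"
  assumes f: "smooth_with L f" and "orthogonal_matrix G" "inj_on enum {1..l}"
    and "\<beta> > 0" "L \<ge> 0" "l \<ge> 1"
  shows "norm (structured_fd enum l f x G \<beta> - sketch enum l G (gradient f x))
      \<le> real CARD('d) / sqrt (real l) * (L * \<beta> / 2)"
proof -
  define \<rho> where "\<rho> j = (f (x + \<beta> *\<^sub>R frame enum G j) - f x) / \<beta> - inner (gradient f x) (frame enum G j)" for j
  have \<rho>: "\<bar>\<rho> j\<bar> \<le> L * \<beta> / 2" for j
  proof -
    have "\<bar>f (x + \<beta> *\<^sub>R frame enum G j) - f x - \<beta> * inner (gradient f x) (frame enum G j)\<bar> \<le> L / 2 * \<beta>\<^sup>2"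
      using linearization_error[OF f, of "x + \<beta> *\<^sub>R frame enum G j" x] norm_frame[OF assms(2)] \<open>\<beta> > 0\<close>
      by simp
    moreover have "\<beta> * \<rho> j = f (x + \<beta> *\<^sub>R frame enum G j) - f x - \<beta> * inner (gradient f x) (frame enum G j)"
      using \<open>\<beta> > 0\<close> by (simp add: \<rho>_def field_simps)
    ultimately have "\<bar>\<beta> * \<rho> j\<bar> \<le> L / 2 * \<beta>\<^sup>2" by simp
    then have "\<beta> * \<bar>\<rho> j\<bar> \<le> \<beta> * (L * \<beta> / 2)"
      using \<open>\<beta> > 0\<close> by (simp add: abs_mult power2_eq_square)
    then show ?thesis using \<open>\<beta> > 0\<close> by simp
  qed
  have "structured_fd enum l f x G \<beta> - sketch enum l G (gradient f x)
      = (real CARD('d) / real l) *\<^sub>R (\<Sum>j = 1..l. \<rho> j *\<^sub>R frame enum G j)"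
    by (simp add: structured_fd_def sketch_def \<rho>_def scaleR_left_diff_distrib sum_subtractf scaleR_diff_right)
  then have eq: "norm (structured_fd enum l f x G \<beta> - sketch enum l G (gradient f x))
      = real CARD('d) / real l * norm (\<Sum>j = 1..l. \<rho> j *\<^sub>R frame enum G j)" by simp
  have "norm (\<Sum>j = 1..l. \<rho> j *\<^sub>R frame enum G j) \<le> sqrt (real l) * (L * \<beta> / 2)"
  proof (rule power2_le_imp_le)
    have "(norm (\<Sum>j = 1..l. \<rho> j *\<^sub>R frame enum G j))\<^sup>2 = (\<Sum>j = 1..l. (\<rho> j)\<^sup>2)"
      using assms by (intro norm_sum_frame) auto
    also have "\<dots> \<le> (\<Sum>j = 1..l. (L * \<beta> / 2)\<^sup>2)"
      by (intro sum_mono abs_le_square_iff[THEN iffD1] order_trans[OF \<rho> abs_ge_self])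
    finally show "(norm (\<Sum>j = 1..l. \<rho> j *\<^sub>R frame enum G j))\<^sup>2 \<le> (sqrt (real l) * (L * \<beta> / 2))\<^sup>2"
      unfolding power_mult_distrib[of "sqrt _"] by simp
  qed (use assms in simp)
  then have "norm (structured_fd enum l f x G \<beta> - sketch enum l G (gradient f x))
      \<le> real CARD('d) / real l * (sqrt (real l) * (L * \<beta> / 2))"
    unfolding eq by (rule mult_left_mono) simp
  also have "\<dots> = real CARD('d) / sqrt (real l) * (L * \<beta> / 2)"
    using \<open>l \<ge> 1\<close> by (simp add: field_simps)
  finally show ?thesis .
qed

text \<open>The full surrogate is the structured one for the standard frame and \<open>l = d\<close>, where the
  sketch is the identity; so its error is a special case of the bound just proved.\<close>

lemma full_fd_as_structured_fd:
  fixes enum :: "nat \<Rightarrow> 'd::finite"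
  shows "full_fd enum f x \<beta> = structured_fd enum CARD('d) f x (mat 1) \<beta>"
  by (simp add: full_fd_def structured_fd_def)

lemma sketch_full:
  fixes enum :: "nat \<Rightarrow> 'd::finite"
  assumes "bij_betw enum {1..CARD('d)} UNIV"
  shows "sketch enum CARD('d) (mat 1) v = v"
proof -
  have "sketch enum CARD('d) (mat 1) v = (\<Sum>j = 1..CARD('d). (v $ enum j) *\<^sub>R axis (enum j) 1)"
    by (simp add: sketch_def basis_vec_def inner_axis)
  also have "\<dots> = (\<Sum>i\<in>UNIV. (v $ i) *\<^sub>R axis i 1)"
    by (rule sum.reindex_bij_betw[OF assms])
  also have "\<dots> = v"
    using basis_expansion[of v] by (simp add: scalar_mult_eq_scaleR)
  finally show ?thesis .
qed

lemma full_fd_error: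
  fixes enum :: "nat \<Rightarrow> 'd::finite"
  assumes "bij_betw enum {1..CARD('d)} UNIV" "smooth_with L f" "\<beta> > 0" "L \<ge> 0"
  shows "norm (full_fd enum f x \<beta> - gradient f x) \<le> sqrt (real CARD('d)) * (L * \<beta> / 2)"
proof -
  have "norm (full_fd enum f x \<beta> - gradient f x)
      \<le> real CARD('d) / sqrt (real CARD('d)) * (L * \<beta> / 2)"
    using structured_fd_linearization[OF assms(2) orthogonal_matrix_id, of enum "CARD('d)" \<beta> x] assms
    by (simp add: full_fd_as_structured_fd sketch_full bij_betw_def)
  then show ?thesis by (simp add: real_div_sqrt)
qed

section \<open>Second moments under the Haar measure\<close>

definition flip_coord :: "'d::finite \<Rightarrow> real ^ 'd \<Rightarrow> real ^ 'd" where
  "flip_coord a v = (\<chi> i. if i = a then - v $ i else v $ i)"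

definition permute_coords :: "('d \<Rightarrow> 'd) \<Rightarrow> real ^ 'd::finite \<Rightarrow> real ^ 'd" where
  "permute_coords p v = (\<chi> i. v $ p i)"

lemma orthogonal_flip_coord: "orthogonal_transformation (flip_coord a)"
  unfolding orthogonal_transformation
  by (auto simp: flip_coord_def linear_iff vec_eq_iff norm_vec_def L2_set_def
      intro!: arg_cong[where f=sqrt] sum.cong)

lemma orthogonal_permute_coords:
  assumes "bij p"
  shows "orthogonal_transformation (permute_coords p)"
  unfolding orthogonal_transformation
  using sum.reindex_bij_betw[OF assms, of "\<lambda>i. (v $ i)\<^sup>2" for v :: "real ^ 'a"]
  by (auto simp: permute_coords_def linear_iff vec_eq_iff norm_vec_def L2_set_def)

lemma measurable_matrix_vector_mult [measurable]:
  assumes A: "A \<in> M \<rightarrow>\<^sub>M (orthogonal_borel :: (real ^ 'd::finite ^ 'd) measure)"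
  shows "(\<lambda>x. A x *v v) \<in> borel_measurable M"
proof (rule measurable_compose[OF A])
  have "(\<lambda>G :: real ^ 'd ^ 'd. G *v v) \<in> borel_measurable borel"
    by (intro borel_measurable_continuous_onI linear_continuous_on)
       (auto intro!: linear_conv_bounded_linear[THEN iffD1]
         simp: linear_iff matrix_vector_mult_add_rdistrib scaleR_matrix_vector_assoc)
  then show "(\<lambda>G. G *v v) \<in> borel_measurable (orthogonal_borel :: (real ^ 'd ^ 'd) measure)"
    by (rule measurable_restrict_space1)
qed

locale haar_orthogonal =
  fixes \<mu> :: "(real ^ 'd::finite ^ 'd) measure"
  assumes haar: "is_normalized_haar \<mu>"
begin

sublocale prob_space \<mu>
  using haar by (simp add: is_normalized_haar_def)

lemma sets_haar [measurable_cong]: "sets \<mu> = sets orthogonal_borel"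
  using haar by (simp add: is_normalized_haar_def)

lemma space_haar: "space \<mu> = orthogonal_mats"
  using sets_eq_imp_space_eq[OF sets_haar] by (simp add: space_restrict_space)

lemma orthogonal_matrix_haar: "G \<in> space \<mu> \<Longrightarrow> orthogonal_matrix G"
  by (simp add: space_haar orthogonal_mats_def)

lemma measurable_frame_haar: "(\<lambda>G. G *v v) \<in> borel_measurable \<mu>"
  by (rule measurable_matrix_vector_mult) (simp add: measurable_ident_sets[OF sets_haar])

lemma measurable_coord_haar [measurable]: "(\<lambda>G. (G *v v) $ a) \<in> borel_measurable \<mu>"
  by (rule measurable_compose[OF measurable_frame_haar])
     (intro borel_measurable_continuous_onI continuous_intros)

lemma expectation_left_mult:
  fixes \<phi> :: "real ^ 'd ^ 'd \<Rightarrow> real"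
  assumes "orthogonal_transformation q" and [measurable]: "\<phi> \<in> borel_measurable \<mu>"
  shows "expectation (\<lambda>G. \<phi> (matrix q ** G)) = expectation \<phi>"
proof -
  let ?Q = "matrix q"
  have Q: "orthogonal_matrix ?Q"
    using assms(1) by (simp add: orthogonal_transformation_matrix)
  have "(\<lambda>G. ?Q ** G) \<in> measurable borel (borel :: (real ^ 'd ^ 'd) measure)"
    by (intro borel_measurable_continuous_onI linear_continuous_on)
       (auto intro!: linear_conv_bounded_linear[THEN iffD1]
         simp: linear_iff matrix_add_ldistrib matrix_scalar_ac vec_eq_iff
           matrix_matrix_mult_def algebra_simps sum_distrib_left sum.distrib)
  then have "(\<lambda>G. ?Q ** G) \<in> measurable orthogonal_borel orthogonal_borel"
    using orthogonal_matrix_mul[OF Q]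
    by (intro measurable_restrict_space3) (auto simp: orthogonal_mats_def)
  then have meas: "(\<lambda>G. ?Q ** G) \<in> measurable \<mu> \<mu>"
    by (simp add: measurable_cong_sets[OF sets_haar sets_haar])
  have "expectation (\<lambda>G. \<phi> (?Q ** G)) = integral\<^sup>L (distr \<mu> \<mu> (\<lambda>G. ?Q ** G)) \<phi>"
    by (rule integral_distr[OF meas assms(2), symmetric])
  also have "distr \<mu> \<mu> (\<lambda>G. ?Q ** G) = \<mu>"
    using haar Q by (simp add: is_normalized_haar_def orthogonal_mats_def)
  finally show ?thesis .
qed

lemma integrable_coord_product:
  assumes "norm e = 1"
  shows "integrable \<mu> (\<lambda>G. (G *v e) $ a * (G *v e) $ b)"
proof (rule integrable_const_bound[where B=1])
  show "AE G in \<mu>. norm ((G *v e) $ a * (G *v e) $ b) \<le> 1"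
  proof (rule AE_I2)
    fix G assume "G \<in> space \<mu>"
    then have "norm (G *v e) = 1"
      using assms orthogonal_matrix_haar[of G]
      by (simp add: orthogonal_transformation_matrix orthogonal_transformation_norm)
    then have "\<bar>(G *v e) $ i\<bar> \<le> 1" for i using component_le_norm_cart[of "G *v e" i] by simp
    then show "norm ((G *v e) $ a * (G *v e) $ b) \<le> 1"
      by (simp add: abs_mult mult_le_one)
  qed
qed (intro borel_measurable_times measurable_coord_haar)

text \<open>For Haar distributed \<open>G\<close>, the law of \<open>G e\<close> is invariant under orthogonal maps. Flipping the sign
  of one coordinate makes distinct coordinates uncorrelated, and exchanging coordinates makes their
  second moments equal, whereupon \<open>\<parallel>G e\<parallel> = 1\<close> fixes the common value.\<close>

lemma expectation_coord_product:
  assumes e: "norm e = 1"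
  shows "expectation (\<lambda>G. (G *v e) $ a * (G *v e) $ b) = (if a = b then 1 / real CARD('d) else 0)"
proof (cases "a = b")
  case False
  have "expectation (\<lambda>G. (G *v e) $ a * (G *v e) $ b)
      = expectation (\<lambda>G. ((matrix (flip_coord a) ** G) *v e) $ a * ((matrix (flip_coord a) ** G) *v e) $ b)"
    by (intro expectation_left_mult[symmetric] borel_measurable_times measurable_coord_haar)
       (rule orthogonal_flip_coord)
  also have "\<dots> = - expectation (\<lambda>G. (G *v e) $ a * (G *v e) $ b)"
    using False
    by (simp add: matrix_vector_mul_assoc[symmetric] orthogonal_transformation_linear
        orthogonal_flip_coord flip_coord_def)
  finally show ?thesis using False by simp
next
  case True
  have meas: "(\<lambda>G. ((G *v e) $ a)\<^sup>2) \<in> borel_measurable \<mu>"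
    by (intro borel_measurable_power measurable_coord_haar)
  have swap: "expectation (\<lambda>G. ((G *v e) $ c)\<^sup>2) = expectation (\<lambda>G. ((G *v e) $ a)\<^sup>2)" for c
  proof -
    let ?q = "permute_coords (Transposition.transpose a c)"
    have "orthogonal_transformation ?q"
      by (rule orthogonal_permute_coords) simp
    then show ?thesis
      using expectation_left_mult[of ?q, OF _ meas]
      by (simp add: matrix_vector_mul_assoc[symmetric] orthogonal_transformation_linear
          permute_coords_def)
  qed
  have "real CARD('d) * expectation (\<lambda>G. ((G *v e) $ a)\<^sup>2)
      = (\<Sum>c\<in>UNIV. expectation (\<lambda>G. ((G *v e) $ c)\<^sup>2))"
    by (subst sum.cong[OF refl swap]) simp
  also have "\<dots> = expectation (\<lambda>G. \<Sum>c\<in>UNIV. ((G *v e) $ c)\<^sup>2)"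
    using integrable_coord_product[OF e]
    by (intro Bochner_Integration.integral_sum[symmetric]) (simp add: power2_eq_square)
  also have "\<dots> = expectation (\<lambda>G. 1)"
  proof (rule Bochner_Integration.integral_cong[OF refl])
    fix G assume "G \<in> space \<mu>"
    then have "norm (G *v e) = 1"
      using e orthogonal_matrix_haar[of G]
      by (simp add: orthogonal_transformation_matrix orthogonal_transformation_norm)
    then show "(\<Sum>c\<in>UNIV. ((G *v e) $ c)\<^sup>2) = 1" by (simp add: norm_vec_def L2_set_def)
  qed
  finally show ?thesis using True by (simp add: power2_eq_square prob_space field_simps)
qed

lemma expectation_frame_product:
  assumes e: "norm e = 1"
  shows "integrable \<mu> (\<lambda>G. inner u (G *v e) * inner w (G *v e))"
    and "expectation (\<lambda>G. inner u (G *v e) * inner w (G *v e)) = inner u w / real CARD('d)"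
proof -
  have expand: "inner u (G *v e) * inner w (G *v e)
      = (\<Sum>a\<in>UNIV. \<Sum>b\<in>UNIV. (u $ a * w $ b) * ((G *v e) $ a * (G *v e) $ b))" for G
    by (simp add: inner_vec_def sum_product mult_ac)
  show "integrable \<mu> (\<lambda>G. inner u (G *v e) * inner w (G *v e))"
    unfolding expand using integrable_coord_product[OF e] by (intro Bochner_Integration.integrable_sum) auto
  have "expectation (\<lambda>G. inner u (G *v e) * inner w (G *v e))
      = (\<Sum>a\<in>UNIV. \<Sum>b\<in>UNIV. (u $ a * w $ b) * (if a = b then 1 / real CARD('d) else 0))"
    unfolding expand using integrable_coord_product[OF e]
    by (subst Bochner_Integration.integral_sum, force,
        intro sum.cong refl, subst Bochner_Integration.integral_sum)
       (auto simp: expectation_coord_product[OF e])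
  also have "\<dots> = (\<Sum>a\<in>UNIV. u $ a * w $ a / real CARD('d))"
    by (intro sum.cong refl) (simp add: if_distrib[of "\<lambda>x. _ * x"] cong: if_cong)
  finally show "expectation (\<lambda>G. inner u (G *v e) * inner w (G *v e)) = inner u w / real CARD('d)"
    by (simp add: inner_vec_def sum_divide_distrib)
qed

lemma expectation_inner_sketch:
  assumes "l \<ge> 1"
  shows "integrable \<mu> (\<lambda>G. inner w (sketch enum l G v))"
    and "expectation (\<lambda>G. inner w (sketch enum l G v)) = inner w v"
proof -
  have e: "norm (basis_vec enum j :: real ^ 'd) = 1" for j by (simp add: basis_vec_def)
  have eq: "inner w (sketch enum l G v)
      = real CARD('d) / real l * (\<Sum>j = 1..l. inner v (frame enum G j) * inner w (frame enum G j))" for G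
    by (simp add: sketch_def inner_sum_right)
  show "integrable \<mu> (\<lambda>G. inner w (sketch enum l G v))"
    unfolding eq using expectation_frame_product(1)[OF e]
    by (intro integrable_mult_right Bochner_Integration.integrable_sum) auto
  show "expectation (\<lambda>G. inner w (sketch enum l G v)) = inner w v"
    unfolding eq using expectation_frame_product[OF e] assms
    by (simp add: inner_commute)
qed

lemma expectation_norm_sketch:
  assumes "l \<ge> 1" "inj_on enum {1..l}"
  shows "integrable \<mu> (\<lambda>G. (norm (sketch enum l G v))\<^sup>2)"
    and "expectation (\<lambda>G. (norm (sketch enum l G v))\<^sup>2) = real CARD('d) / real l * (norm v)\<^sup>2"
proof -
  have eq: "(norm (sketch enum l G v))\<^sup>2 = real CARD('d) / real l * inner v (sketch enum l G v)"
    if "G \<in> space \<mu>" for G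
    using norm_sketch_power2[OF orthogonal_matrix_haar[OF that] assms(2)] .
  show "integrable \<mu> (\<lambda>G. (norm (sketch enum l G v))\<^sup>2)"
    using expectation_inner_sketch(1)[OF assms(1), of v enum v]
    by (subst Bochner_Integration.integrable_cong[OF refl eq]) auto
  show "expectation (\<lambda>G. (norm (sketch enum l G v))\<^sup>2) = real CARD('d) / real l * (norm v)\<^sup>2"
    using expectation_inner_sketch[OF assms(1), of v enum v]
    by (subst Bochner_Integration.integral_cong[OF refl eq])
       (auto simp: power2_norm_eq_inner simp del: norm_eq_sqrt_inner)
qed

end

section \<open>One step of the method\<close>

text \<open>Let \<open>y\<close> be the exact proximal gradient step and \<open>p\<close> the actual one. The subgradient inequality
  at \<open>y\<close> is tested at \<open>x\<close> and the one at \<open>p\<close> is tested at \<open>y\<close>; with the descent inequality for \<open>f\<close>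
  from \<open>x\<close> to \<open>p\<close> this leaves the mixed term \<open>\<langle>v - \<nabla>f(x), y - p\<rangle>\<close>. Young's inequality splits it so
  that its \<open>\<parallel>p - y\<parallel>\<^sup>2\<close> part cancels against the one that polarization of \<open>\<langle>x - p, y - p\<rangle>\<close> produces.\<close>

lemma prox_gradient_descent:
  fixes f :: "'a::euclidean_space \<Rightarrow> real"
  assumes h: "convex_ext h" "proximable h" and \<gamma>: "\<gamma> > 0" and f: "smooth_with L f"
    and x: "\<bar>h x\<bar> \<noteq> \<infinity>" and p: "p = prox \<gamma> h (x - \<gamma> *\<^sub>R v)"
  shows "f p + real_of_ereal (h p) \<le> f x + real_of_ereal (h x)
    - \<gamma> / 2 * (norm (gradient_mapping \<gamma> f h x))\<^sup>2
    - (1 / (2 * \<gamma>) - L / 2) * (norm (p - x))\<^sup>2 + \<gamma> / 2 * (norm (v - gradient f x))\<^sup>2"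
proof -
  define g where "g = gradient f x"
  define y where "y = prox \<gamma> h (x - \<gamma> *\<^sub>R g)"
  define c where "c = 1 / \<gamma>"
  define hr where "hr z = real_of_ereal (h z)" for z
  have c: "c > 0" "c * \<gamma> = 1" using \<gamma> by (simp_all add: c_def)
  have y_fin: "\<bar>h y\<bar> \<noteq> \<infinity>" unfolding y_def by (rule prox_finite[OF h \<gamma>])
  have "hr y + c * inner (x - \<gamma> *\<^sub>R g - y) (x - y) \<le> hr x"
    using prox_subgradient[OF h \<gamma> y_def x] by (simp add: hr_def c_def)
  moreover have "c * inner (x - \<gamma> *\<^sub>R g - y) (x - y) = c * (norm (x - y))\<^sup>2 - (c * \<gamma>) * inner g (x - y)"
    by (simp add: power2_norm_eq_inner inner_diff_left right_diff_distrib del: norm_eq_sqrt_inner)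
  ultimately have 1: "hr y \<le> hr x - c * (norm (x - y))\<^sup>2 + inner g (x - y)"
    by (simp add: c(2))
  have "hr p + c * inner (x - \<gamma> *\<^sub>R v - p) (y - p) \<le> hr y"
    using prox_subgradient[OF h \<gamma> p y_fin] by (simp add: hr_def c_def)
  moreover have "c * inner (x - \<gamma> *\<^sub>R v - p) (y - p) = c * inner (x - p) (y - p) - (c * \<gamma>) * inner v (y - p)"
    by (simp add: inner_diff_left right_diff_distrib)
  ultimately have 2: "hr p \<le> hr y - c * inner (x - p) (y - p) + inner v (y - p)"
    by (simp add: c(2))
  have 3: "f p \<le> f x + inner g (p - x) + L / 2 * (norm (p - x))\<^sup>2"
    unfolding g_def by (rule descent_inequality[OF f])
  have polar: "inner (x - p) (y - p) = ((norm (p - x))\<^sup>2 + (norm (p - y))\<^sup>2 - (norm (x - y))\<^sup>2) / 2"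
    by (simp add: power2_norm_eq_inner inner_diff_left inner_diff_right inner_commute
        del: norm_eq_sqrt_inner)
  have young: "inner (v - g) (y - p) \<le> \<gamma> / 2 * (norm (v - g))\<^sup>2 + c / 2 * (norm (p - y))\<^sup>2"
  proof -
    define a w where "a = y - p" and "w = v - g"
    have "0 \<le> c / 2 * (norm (a - \<gamma> *\<^sub>R w))\<^sup>2" using c by simp
    also have "\<dots> = c / 2 * (norm a)\<^sup>2 - (c * \<gamma>) * inner w a + (c * \<gamma>) * (\<gamma> / 2 * (norm w)\<^sup>2)"
      unfolding power2_norm_eq_inner
      by (simp add: inner_diff_left inner_diff_right inner_commute[of a w] algebra_simps)
    finally have "inner w a \<le> \<gamma> / 2 * (norm w)\<^sup>2 + c / 2 * (norm a)\<^sup>2" by (simp add: c(2))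
    then show ?thesis by (simp add: a_def w_def norm_minus_commute)
  qed
  have "inner g (x - y) + inner g (p - x) + inner v (y - p) = inner (v - g) (y - p)"
    by (simp add: inner_diff_left inner_diff_right)
  moreover have "c * inner (x - p) (y - p)
      = c / 2 * (norm (p - x))\<^sup>2 + c / 2 * (norm (p - y))\<^sup>2 - c / 2 * (norm (x - y))\<^sup>2"
    unfolding polar by (simp add: field_simps)
  ultimately have "f p + hr p \<le> f x + hr x - c / 2 * (norm (x - y))\<^sup>2
      - (c / 2 - L / 2) * (norm (p - x))\<^sup>2 + \<gamma> / 2 * (norm (v - g))\<^sup>2"
    using 1 2 3 young by (simp add: left_diff_distrib)
  moreover have "\<gamma> / 2 * (norm (gradient_mapping \<gamma> f h x))\<^sup>2 = c / 2 * (norm (x - y))\<^sup>2"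
    using \<gamma> by (simp add: gradient_mapping_def y_def g_def c_def power_divide power2_eq_square)
  moreover have "c / 2 = 1 / (2 * \<gamma>)" by (simp add: c_def)
  ultimately show ?thesis unfolding hr_def g_def by simp
qed


text \<open>By the Cauchy-Schwarz inequality \<open>\<parallel>x\<^sub>k - x\<^sub>0\<parallel>\<^sup>2\<close> is at most \<open>k\<close> times the sum of all squared
  steps, and \<open>0 + 1 + \<dots> + (m - 1) \<le> m\<^sup>2 / 2\<close>.\<close>

lemma sum_drift_le:
  fixes x :: "nat \<Rightarrow> 'a::real_normed_vector"
  shows "(\<Sum>k<m. (norm (x k - x 0))\<^sup>2) \<le> (real m)\<^sup>2 / 2 * (\<Sum>k<m. (norm (x (Suc k) - x k))\<^sup>2)"
proof -
  define S where "S = (\<Sum>k<m. (norm (x (Suc k) - x k))\<^sup>2)"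
  have "S \<ge> 0" by (simp add: S_def sum_nonneg)
  have "(norm (x k - x 0))\<^sup>2 \<le> real k * S" if "k < m" for k
  proof -
    have "norm (x k - x 0) \<le> (\<Sum>j<k. norm (x (Suc j) - x j))"
      using norm_sum[of "\<lambda>j. x (Suc j) - x j" "{..<k}"] by (simp add: sum_lessThan_telescope)
    then have "(norm (x k - x 0))\<^sup>2 \<le> (\<Sum>j<k. norm (x (Suc j) - x j))\<^sup>2"
      by (rule power_mono) simp
    also have "\<dots> \<le> (\<Sum>j<k. 1\<^sup>2) * (\<Sum>j<k. (norm (x (Suc j) - x j))\<^sup>2)"
      using Cauchy_Schwarz_ineq_sum[of "\<lambda>_. 1" "\<lambda>j. norm (x (Suc j) - x j)" "{..<k}"] by simp
    also have "\<dots> \<le> real k * S"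
      unfolding S_def using that by (auto intro!: mult_left_mono sum_mono2)
    finally show ?thesis .
  qed
  then have "(\<Sum>k<m. (norm (x k - x 0))\<^sup>2) \<le> (\<Sum>k<m. real k) * S"
    unfolding sum_distrib_right by (intro sum_mono) simp
  also have "(\<Sum>k<m. real k) = real m * (real m - 1) / 2"
    by (induction m) (auto simp: field_simps)
  also have "real m * (real m - 1) / 2 * S \<le> (real m)\<^sup>2 / 2 * S"
    using \<open>S \<ge> 0\<close> by (intro mult_right_mono) (auto simp: power2_eq_square algebra_simps)
  finally show ?thesis by (simp add: S_def)
qed

text \<open>The contribution of one draw \<open>(i, G)\<close> to the error of the search direction at \<open>x\<close> with anchor \<open>x0\<close>,
  without finite-difference errors. The subtracted term is the mean of the first one when \<open>i\<close> is
  uniform and \<open>G\<close> is Haar distributed.\<close>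

definition fluctuation ::
    "(nat \<Rightarrow> 'd::finite) \<Rightarrow> nat \<Rightarrow> nat \<Rightarrow> (nat \<Rightarrow> real ^ 'd \<Rightarrow> real) \<Rightarrow>
     nat \<times> (real ^ 'd ^ 'd) \<Rightarrow> (real ^ 'd) \<times> (real ^ 'd) \<Rightarrow> real ^ 'd" where
  "fluctuation enum l n fs = (\<lambda>(i, G) (x, x0).
     sketch enum l G (gradient (fs i) x - gradient (fs i) x0)
     - (gradient (finite_sum n fs) x - gradient (finite_sum n fs) x0))"

lemma sketch_diff: "sketch enum l G (u - v) = sketch enum l G u - sketch enum l G v"
  by (simp add: sketch_def inner_diff_left scaleR_left_diff_distrib sum_subtractf scaleR_diff_right)

lemma norm_sketch_le:
  fixes enum :: "nat \<Rightarrow> 'd::finite"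
  assumes "orthogonal_matrix G" "inj_on enum {1..l}"
  shows "norm (sketch enum l G v) \<le> real CARD('d) / real l * norm v"
proof (cases "sketch enum l G v = 0")
  case False
  have "(norm (sketch enum l G v))\<^sup>2 \<le> real CARD('d) / real l * (norm v * norm (sketch enum l G v))"
    unfolding norm_sketch_power2[OF assms] by (intro mult_left_mono norm_cauchy_schwarz) simp
  then have "norm (sketch enum l G v) * norm (sketch enum l G v)
      \<le> (real CARD('d) / real l * norm v) * norm (sketch enum l G v)"
    by (simp add: power2_eq_square)
  then show ?thesis using False by (simp only: mult_le_cancel_right) auto
qed simp

lemma power2_norm_add_le: "(norm (x + y))\<^sup>2 \<le> 2 * (norm x)\<^sup>2 + 2 * (norm (y :: 'a::real_inner))\<^sup>2"
proof -
  have "(norm (x + y))\<^sup>2 + (norm (x - y))\<^sup>2 = 2 * (norm x)\<^sup>2 + 2 * (norm y)\<^sup>2"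
    by (simp add: power2_norm_eq_inner inner_add_left inner_add_right inner_diff_left
        inner_diff_right del: norm_eq_sqrt_inner)
  then show ?thesis by (smt (verit) zero_le_power2)
qed

text \<open>The sampled differences of surrogates contribute their fluctuation, the common mean
  \<open>\<nabla>f(x) - \<nabla>f(x\<^sub>0)\<close>, and the linearization errors; the full surrogate contributes
  \<open>\<nabla>f(x\<^sub>0)\<close> and its own error. The gradients at the anchor cancel, so that only the fluctuations and
  the linearization errors remain.\<close>

lemma vr_direction_error:
  fixes enum :: "nat \<Rightarrow> 'd::finite" and fs :: "nat \<Rightarrow> real ^ 'd \<Rightarrow> real"
  assumes enum: "bij_betw enum {1..CARD('d)} UNIV" and l: "1 \<le> l" "l \<le> CARD('d)" and b: "b \<ge> 1"
    and f: "smooth_with L (finite_sum n fs)" and fs: "\<And>j. j \<in> {1..b} \<Longrightarrow> smooth_with L (fs (ix j))"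
    and G: "\<And>j. j \<in> {1..b} \<Longrightarrow> orthogonal_matrix (G j)" and \<beta>: "\<beta> > 0" and L: "L \<ge> 0"
  shows "(norm (vr_direction enum n fs l b \<beta> ix G x x0 - gradient (finite_sum n fs) x))\<^sup>2
    \<le> 2 * (norm ((1 / real b) *\<^sub>R (\<Sum>j = 1..b. fluctuation enum l n fs (ix j, G j) (x, x0))))\<^sup>2
      + (4 * (real CARD('d))\<^sup>2 + real CARD('d)) * L\<^sup>2 * \<beta>\<^sup>2"
proof -
  let ?d = "real CARD('d)"
  define r where "r j y = structured_fd enum l (fs (ix j)) y (G j) \<beta> - sketch enum l (G j) (gradient (fs (ix j)) y)" for j y
  (* A: fluctuation; R: linearization errors of the sampled differences; S: error of the full surrogate. *)
  define A where "A = (1 / real b) *\<^sub>R (\<Sum>j = 1..b. fluctuation enum l n fs (ix j, G j) (x, x0))"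
  define R where "R = (1 / real b) *\<^sub>R (\<Sum>j = 1..b. r j x - r j x0)"
  define S where "S = full_fd enum (finite_sum n fs) x0 \<beta> - gradient (finite_sum n fs) x0"
  define D where "D = gradient (finite_sum n fs) x - gradient (finite_sum n fs) x0"
  have inj: "inj_on enum {1..l}"
    using enum l by (auto simp: bij_betw_def intro: inj_on_subset)
  have meanD: "(1 / real b) *\<^sub>R (\<Sum>j = 1..b. D) = D"
    using b by (simp add: sum_constant_scaleR del: sum_constant)
  have "structured_fd enum l (fs (ix j)) x (G j) \<beta> - structured_fd enum l (fs (ix j)) x0 (G j) \<beta>
      = (fluctuation enum l n fs (ix j, G j) (x, x0) + (r j x - r j x0)) + D" for j
    by (simp add: fluctuation_def r_def D_def sketch_diff)
  then have "vr_direction enum n fs l b \<beta> ix G x x0 = (A + R) + D + full_fd enum (finite_sum n fs) x0 \<beta>"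
    using meanD by (simp add: vr_direction_def A_def R_def sum.distrib scaleR_add_right del: sum_constant)
  then have decomp: "vr_direction enum n fs l b \<beta> ix G x x0 - gradient (finite_sum n fs) x = A + (R + S)"
    by (simp add: D_def S_def)
  have r: "norm (r j y) \<le> ?d * (L * \<beta> / 2)" if "j \<in> {1..b}" for j y
  proof -
    have "norm (r j y) \<le> ?d / sqrt (real l) * (L * \<beta> / 2)"
      unfolding r_def by (rule structured_fd_linearization[OF fs[OF that] G[OF that] inj \<beta> L l(1)])
    also have "\<dots> \<le> ?d * (L * \<beta> / 2)"
      using l \<beta> L by (intro mult_right_mono) (auto simp: divide_le_eq)
    finally show ?thesis .
  qed
  have "norm R = 1 / real b * norm (\<Sum>j = 1..b. r j x - r j x0)" by (simp add: R_def)
  also have "\<dots> \<le> 1 / real b * (\<Sum>j = 1..b. ?d * (L * \<beta>))"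
  proof (intro mult_left_mono sum_norm_le)
    fix j assume j: "j \<in> {1..b}"
    have "norm (r j x - r j x0) \<le> norm (r j x) + norm (r j x0)" by (rule norm_triangle_ineq4)
    also have "\<dots> \<le> ?d * (L * \<beta>)" using r[OF j, of x] r[OF j, of x0] by simp
    finally show "norm (r j x - r j x0) \<le> ?d * (L * \<beta>)" .
  qed simp
  also have "\<dots> = ?d * (L * \<beta>)" using b by simp
  finally have "(norm R)\<^sup>2 \<le> (?d * (L * \<beta>))\<^sup>2" by (rule power_mono) simp
  moreover have "(norm S)\<^sup>2 \<le> (sqrt ?d * (L * \<beta> / 2))\<^sup>2"
    unfolding S_def by (intro power_mono full_fd_error[OF enum f \<beta> L]) simp
  moreover have "(sqrt ?d * (L * \<beta> / 2))\<^sup>2 = ?d * (L * \<beta>)\<^sup>2 / 4"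
    unfolding power_mult_distrib[of "sqrt _"] by (simp add: power_divide)
  ultimately have "(norm (R + S))\<^sup>2 \<le> 2 * (?d * (L * \<beta>))\<^sup>2 + ?d * (L * \<beta>)\<^sup>2 / 2"
    using power2_norm_add_le[of R S] by linarith
  then have "(norm (A + (R + S)))\<^sup>2 \<le> 2 * (norm A)\<^sup>2 + 2 * (2 * (?d * (L * \<beta>))\<^sup>2 + ?d * (L * \<beta>)\<^sup>2 / 2)"
    by (intro order_trans[OF power2_norm_add_le[of A "R + S"]] add_left_mono mult_left_mono) auto
  also have "\<dots> = 2 * (norm A)\<^sup>2 + (4 * ?d\<^sup>2 + ?d) * L\<^sup>2 * \<beta>\<^sup>2"
    by (simp add: power_mult_distrib algebra_simps)
  finally show ?thesis unfolding decomp A_def .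
qed

lemma norm_fluctuation_le:
  fixes enum :: "nat \<Rightarrow> 'd::finite" and fs :: "nat \<Rightarrow> real ^ 'd \<Rightarrow> real"
  assumes "inj_on enum {1..l}" and f: "smooth_with L (finite_sum n fs)" and fs: "smooth_with L (fs i)"
    and G: "orthogonal_matrix G"
  shows "norm (fluctuation enum l n fs (i, G) (x, x0)) \<le> (real CARD('d) / real l + 1) * (L * norm (x - x0))"
proof -
  have "norm (fluctuation enum l n fs (i, G) (x, x0))
      \<le> norm (sketch enum l G (gradient (fs i) x - gradient (fs i) x0))
        + norm (gradient (finite_sum n fs) x - gradient (finite_sum n fs) x0)"
    unfolding fluctuation_def by (simp add: norm_triangle_ineq4)
  also have "norm (sketch enum l G (gradient (fs i) x - gradient (fs i) x0))
      \<le> real CARD('d) / real l * norm (gradient (fs i) x - gradient (fs i) x0)"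
    by (rule norm_sketch_le[OF G assms(1)])
  also have "\<dots> \<le> real CARD('d) / real l * (L * norm (x - x0))"
    using fs by (intro mult_left_mono) (auto simp: smooth_with_def)
  also have "norm (gradient (finite_sum n fs) x - gradient (finite_sum n fs) x0) \<le> L * norm (x - x0)"
    using f by (simp add: smooth_with_def)
  finally show ?thesis by (simp add: distrib_right)
qed

section \<open>Sums of conditionally centred random vectors\<close>

text \<open>Independence is phrased by the product law, so that the two random variables may take values of
  different types.\<close>

definition (in prob_space) indep_pair :: "'c measure \<Rightarrow> ('a \<Rightarrow> 'c) \<Rightarrow> 'b measure \<Rightarrow> ('a \<Rightarrow> 'b) \<Rightarrow> bool" where
  "indep_pair N Y S Z \<longleftrightarrow> random_variable N Y \<and> random_variable S Z \<and>
     distr M N Y \<Otimes>\<^sub>M distr M S Z = distr M (N \<Otimes>\<^sub>M S) (\<lambda>\<omega>. (Y \<omega>, Z \<omega>))"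

lemma (in prob_space) indep_pair_compose:
  assumes "indep_pair N Y S Z" and f: "f \<in> N \<rightarrow>\<^sub>M N'" and g: "g \<in> S \<rightarrow>\<^sub>M S'"
  shows "indep_pair N' (\<lambda>\<omega>. f (Y \<omega>)) S' (\<lambda>\<omega>. g (Z \<omega>))"
proof -
  have Y: "random_variable N Y" and Z: "random_variable S Z"
    and joint: "distr M N Y \<Otimes>\<^sub>M distr M S Z = distr M (N \<Otimes>\<^sub>M S) (\<lambda>\<omega>. (Y \<omega>, Z \<omega>))"
    using assms(1) unfolding indep_pair_def by auto
  have f': "f \<in> distr M N Y \<rightarrow>\<^sub>M N'" and g': "g \<in> distr M S Z \<rightarrow>\<^sub>M S'" using f g by simp_all
  have fY: "random_variable N' (\<lambda>\<omega>. f (Y \<omega>))" and gZ: "random_variable S' (\<lambda>\<omega>. g (Z \<omega>))"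
    using measurable_compose[OF Y f] measurable_compose[OF Z g] by simp_all
  have YZ: "(\<lambda>\<omega>. (Y \<omega>, Z \<omega>)) \<in> M \<rightarrow>\<^sub>M N \<Otimes>\<^sub>M S" using Y Z by measurable
  have fg: "(\<lambda>(y, z). (f y, g z)) \<in> N \<Otimes>\<^sub>M S \<rightarrow>\<^sub>M N' \<Otimes>\<^sub>M S'" using f g by measurable
  interpret gZ: prob_space "distr M S' (\<lambda>\<omega>. g (Z \<omega>))" by (rule prob_space_distr[OF gZ])
  have "distr M N' (\<lambda>\<omega>. f (Y \<omega>)) = distr (distr M N Y) N' f"
    "distr M S' (\<lambda>\<omega>. g (Z \<omega>)) = distr (distr M S Z) S' g"
    using distr_distr[OF f Y] distr_distr[OF g Z] by (simp_all add: comp_def)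
  then have "distr M N' (\<lambda>\<omega>. f (Y \<omega>)) \<Otimes>\<^sub>M distr M S' (\<lambda>\<omega>. g (Z \<omega>))
      = distr (distr M N Y \<Otimes>\<^sub>M distr M S Z) (N' \<Otimes>\<^sub>M S') (\<lambda>(y, z). (f y, g z))"
    using pair_measure_distr[OF f' g'] gZ.sigma_finite_measure_axioms by simp
  also have "\<dots> = distr M (N' \<Otimes>\<^sub>M S') (\<lambda>\<omega>. (f (Y \<omega>), g (Z \<omega>)))"
    unfolding joint distr_distr[OF fg YZ] by (simp add: comp_def)
  finally show ?thesis using fY gZ by (simp add: indep_pair_def)
qed

lemma (in prob_space) expectation_indep_pair:
  fixes \<phi> :: "'c \<times> 'b \<Rightarrow> real"
  assumes indep: "indep_pair N Y S Z" and \<phi>: "\<phi> \<in> borel_measurable (N \<Otimes>\<^sub>M S)"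
    and int: "integrable M (\<lambda>\<omega>. \<phi> (Y \<omega>, Z \<omega>))"
  shows "integrable M (\<lambda>\<omega>. \<integral>z. \<phi> (Y \<omega>, z) \<partial>distr M S Z)"
    and "expectation (\<lambda>\<omega>. \<phi> (Y \<omega>, Z \<omega>)) = expectation (\<lambda>\<omega>. \<integral>z. \<phi> (Y \<omega>, z) \<partial>distr M S Z)"
proof -
  have Y: "random_variable N Y" and Z: "random_variable S Z"
    and joint: "distr M N Y \<Otimes>\<^sub>M distr M S Z = distr M (N \<Otimes>\<^sub>M S) (\<lambda>\<omega>. (Y \<omega>, Z \<omega>))"
    using indep unfolding indep_pair_def by auto
  have YZ: "(\<lambda>\<omega>. (Y \<omega>, Z \<omega>)) \<in> M \<rightarrow>\<^sub>M N \<Otimes>\<^sub>M S" using Y Z by measurable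
  interpret Y: prob_space "distr M N Y" by (rule prob_space_distr[OF Y])
  interpret Z: prob_space "distr M S Z" by (rule prob_space_distr[OF Z])
  interpret pair_sigma_finite "distr M N Y" "distr M S Z" ..
  have int': "integrable (distr M N Y \<Otimes>\<^sub>M distr M S Z) \<phi>"
    unfolding joint using int by (simp add: integrable_distr_eq[OF YZ \<phi>])
  have meas: "(\<lambda>y. \<integral>z. \<phi> (y, z) \<partial>distr M S Z) \<in> borel_measurable N"
    using \<phi> by (intro Z.borel_measurable_lebesgue_integral) (simp add: measurable_distr_eq1 split_beta' cong: measurable_cong_sets)
  show "integrable M (\<lambda>\<omega>. \<integral>z. \<phi> (Y \<omega>, z) \<partial>distr M S Z)"
    using integrable_fst'[OF int'] by (simp add: integrable_distr_eq[OF Y meas])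
  have "expectation (\<lambda>\<omega>. \<phi> (Y \<omega>, Z \<omega>)) = integral\<^sup>L (distr M N Y \<Otimes>\<^sub>M distr M S Z) \<phi>"
    unfolding joint by (rule integral_distr[OF YZ \<phi>, symmetric])
  also have "\<dots> = (\<integral>y. \<integral>z. \<phi> (y, z) \<partial>distr M S Z \<partial>distr M N Y)"
    by (rule integral_fst'[OF int', symmetric])
  also have "\<dots> = expectation (\<lambda>\<omega>. \<integral>z. \<phi> (Y \<omega>, z) \<partial>distr M S Z)"
    by (rule integral_distr[OF Y meas])
  finally show "expectation (\<lambda>\<omega>. \<phi> (Y \<omega>, Z \<omega>)) = expectation (\<lambda>\<omega>. \<integral>z. \<phi> (Y \<omega>, z) \<partial>distr M S Z)" .
qed

text \<open>For fixed \<open>w\<close> the vector \<open>\<psi> (Z j) w\<close> has mean zero. Since \<open>Z j\<close> is independent of the pair of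
  \<open>W\<close> and \<open>Z i\<close>, integrating \<open>Z j\<close> out first kills the inner product of the \<open>i\<close>th and the \<open>j\<close>th
  summand, and the squared norm of the sum has the expectation of the sum of the squared norms. This
  is where averaging over a batch gains its factor \<open>1 / b\<close>.\<close>

lemma (in prob_space) expectation_norm_sum_centred_le:
  fixes \<psi> :: "'b \<Rightarrow> 'c \<Rightarrow> 'e::euclidean_space"
  assumes fin: "finite J"
    and indep: "\<And>j. j \<in> J \<Longrightarrow> indep_pair N W S (Z j)"
    and indep2: "\<And>i j. i \<in> J \<Longrightarrow> j \<in> J \<Longrightarrow> i \<noteq> j \<Longrightarrow> indep_pair (N \<Otimes>\<^sub>M S) (\<lambda>\<omega>. (W \<omega>, Z i \<omega>)) S (Z j)"
    and \<psi>: "(\<lambda>(w, z). \<psi> z w) \<in> borel_measurable (N \<Otimes>\<^sub>M S)"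
    and bounded: "\<And>j \<omega>. j \<in> J \<Longrightarrow> \<omega> \<in> space M \<Longrightarrow> norm (\<psi> (Z j \<omega>) (W \<omega>)) \<le> C"
    and centred: "\<And>j w u. j \<in> J \<Longrightarrow> (\<integral>z. inner u (\<psi> z w) \<partial>distr M S (Z j)) = 0"
    and var: "\<And>j w. j \<in> J \<Longrightarrow> (\<integral>z. (norm (\<psi> z w))\<^sup>2 \<partial>distr M S (Z j)) \<le> V w"
    and V: "integrable M (\<lambda>\<omega>. V (W \<omega>))"
  shows "integrable M (\<lambda>\<omega>. (norm (\<Sum>j\<in>J. \<psi> (Z j \<omega>) (W \<omega>)))\<^sup>2)"
    and "expectation (\<lambda>\<omega>. (norm (\<Sum>j\<in>J. \<psi> (Z j \<omega>) (W \<omega>)))\<^sup>2)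
      \<le> real (card J) * expectation (\<lambda>\<omega>. V (W \<omega>))"
proof -
  define Y where "Y j \<omega> = \<psi> (Z j \<omega>) (W \<omega>)" for j \<omega>
  have WZ: "(\<lambda>\<omega>. (W \<omega>, Z j \<omega>)) \<in> M \<rightarrow>\<^sub>M N \<Otimes>\<^sub>M S" if "j \<in> J" for j
    using indep[OF that] unfolding indep_pair_def by (intro measurable_Pair) auto
  have Y [measurable]: "Y j \<in> borel_measurable M" if "j \<in> J" for j
    using measurable_compose[OF WZ[OF that] \<psi>] by (simp add: Y_def[abs_def])
  have prod_int: "integrable M (\<lambda>\<omega>. inner (Y i \<omega>) (Y j \<omega>))" if "i \<in> J" "j \<in> J" for i j
  proof (rule integrable_const_bound[where B="C * C"])
    show "AE \<omega> in M. norm (inner (Y i \<omega>) (Y j \<omega>)) \<le> C * C"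
    proof (rule AE_I2)
      fix \<omega> assume \<omega>: "\<omega> \<in> space M"
      have "norm (inner (Y i \<omega>) (Y j \<omega>)) \<le> norm (Y i \<omega>) * norm (Y j \<omega>)"
        using Cauchy_Schwarz_ineq2 by simp
      also have "\<dots> \<le> C * C"
        using bounded[OF that(1) \<omega>] bounded[OF that(2) \<omega>]
        unfolding Y_def by (intro mult_mono) (auto intro: order_trans[OF norm_ge_zero])
      finally show "norm (inner (Y i \<omega>) (Y j \<omega>)) \<le> C * C" .
    qed
  qed (use that in measurable)
  have cross: "expectation (\<lambda>\<omega>. inner (Y i \<omega>) (Y j \<omega>)) = 0" if ij: "i \<in> J" "j \<in> J" "i \<noteq> j" for i j
  proof -
    define \<phi> where "\<phi> = (\<lambda>((w, z'), z). inner (\<psi> z' w) (\<psi> z w))"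
    have fst: "fst \<in> (N \<Otimes>\<^sub>M S) \<Otimes>\<^sub>M S \<rightarrow>\<^sub>M N \<Otimes>\<^sub>M S" by measurable
    have fst_snd: "(\<lambda>p. (fst (fst p), snd p)) \<in> (N \<Otimes>\<^sub>M S) \<Otimes>\<^sub>M S \<rightarrow>\<^sub>M N \<Otimes>\<^sub>M S" by measurable
    have \<phi>: "\<phi> \<in> borel_measurable ((N \<Otimes>\<^sub>M S) \<Otimes>\<^sub>M S)"
      using borel_measurable_inner[OF measurable_compose[OF fst \<psi>] measurable_compose[OF fst_snd \<psi>]]
      by (simp add: \<phi>_def case_prod_unfold)
    have "integrable M (\<lambda>\<omega>. \<phi> ((W \<omega>, Z i \<omega>), Z j \<omega>))"
      using prod_int[OF ij(1,2)] by (simp add: \<phi>_def Y_def)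
    from expectation_indep_pair(2)[OF indep2[OF ij] \<phi> this]
    show ?thesis by (simp add: \<phi>_def Y_def centred[OF ij(2)])
  qed
  have diag: "expectation (\<lambda>\<omega>. inner (Y j \<omega>) (Y j \<omega>)) \<le> expectation (\<lambda>\<omega>. V (W \<omega>))" if j: "j \<in> J" for j
  proof -
    define \<phi> where "\<phi> = (\<lambda>(w, z). (norm (\<psi> z w))\<^sup>2)"
    have \<phi>: "\<phi> \<in> borel_measurable (N \<Otimes>\<^sub>M S)"
      using borel_measurable_power[OF measurable_compose[OF \<psi> borel_measurable_norm], of 2]
      by (simp add: \<phi>_def case_prod_unfold)
    have int: "integrable M (\<lambda>\<omega>. \<phi> (W \<omega>, Z j \<omega>))"
      using prod_int[OF j j] by (simp add: \<phi>_def Y_def power2_norm_eq_inner del: norm_eq_sqrt_inner)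
    have "expectation (\<lambda>\<omega>. inner (Y j \<omega>) (Y j \<omega>)) = expectation (\<lambda>\<omega>. \<phi> (W \<omega>, Z j \<omega>))"
      by (simp add: \<phi>_def Y_def power2_norm_eq_inner del: norm_eq_sqrt_inner)
    also have "\<dots> = expectation (\<lambda>\<omega>. \<integral>z. \<phi> (W \<omega>, z) \<partial>distr M S (Z j))"
      by (rule expectation_indep_pair(2)[OF indep[OF j] \<phi> int])
    also have "\<dots> \<le> expectation (\<lambda>\<omega>. V (W \<omega>))"
      using var[OF j] by (intro integral_mono expectation_indep_pair(1)[OF indep[OF j] \<phi> int] V) (simp add: \<phi>_def)
    finally show ?thesis .
  qed
  have expand: "(norm (\<Sum>j\<in>J. \<psi> (Z j \<omega>) (W \<omega>)))\<^sup>2 = (\<Sum>i\<in>J. \<Sum>j\<in>J. inner (Y i \<omega>) (Y j \<omega>))" for \<omega>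
    by (subst inner_commute)
       (simp add: Y_def power2_norm_eq_inner inner_sum_left inner_sum_right del: norm_eq_sqrt_inner)
  show "integrable M (\<lambda>\<omega>. (norm (\<Sum>j\<in>J. \<psi> (Z j \<omega>) (W \<omega>)))\<^sup>2)"
    unfolding expand using prod_int by (intro Bochner_Integration.integrable_sum)
  have "expectation (\<lambda>\<omega>. (norm (\<Sum>j\<in>J. \<psi> (Z j \<omega>) (W \<omega>)))\<^sup>2)
      = (\<Sum>i\<in>J. expectation (\<lambda>\<omega>. \<Sum>j\<in>J. inner (Y i \<omega>) (Y j \<omega>)))"
    unfolding expand using prod_int
    by (intro Bochner_Integration.integral_sum Bochner_Integration.integrable_sum)
  also have "\<dots> = (\<Sum>i\<in>J. \<Sum>j\<in>J. expectation (\<lambda>\<omega>. inner (Y i \<omega>) (Y j \<omega>)))"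
    using prod_int by (intro sum.cong refl Bochner_Integration.integral_sum)
  also have "\<dots> = (\<Sum>i\<in>J. \<Sum>j\<in>J. if i = j then expectation (\<lambda>\<omega>. inner (Y i \<omega>) (Y i \<omega>)) else 0)"
    using cross by (intro sum.cong refl) auto
  also have "\<dots> = (\<Sum>i\<in>J. expectation (\<lambda>\<omega>. inner (Y i \<omega>) (Y i \<omega>)))"
    using fin by simp
  also have "\<dots> \<le> (\<Sum>i\<in>J. expectation (\<lambda>\<omega>. V (W \<omega>)))"
    by (rule sum_mono[OF diag])
  finally show "expectation (\<lambda>\<omega>. (norm (\<Sum>j\<in>J. \<psi> (Z j \<omega>) (W \<omega>)))\<^sup>2)
      \<le> real (card J) * expectation (\<lambda>\<omega>. V (W \<omega>))" by simp
qed

section \<open>The iterates as functions of the draws\<close>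

abbreviation draw_space :: "nat \<Rightarrow> (nat \<times> (real ^ 'd::finite ^ 'd)) measure" where
  "draw_space n \<equiv> count_space {1..n} \<Otimes>\<^sub>M orthogonal_borel"

lemma space_draw_space: "space (draw_space n) = {1..n} \<times> {Q. orthogonal_matrix Q}"
  by (simp add: space_pair_measure space_restrict_space orthogonal_mats_def)

lemma measurable_sketch:
  assumes [measurable]: "A \<in> M \<rightarrow>\<^sub>M (orthogonal_borel :: (real ^ 'd::finite ^ 'd) measure)"
    "v \<in> borel_measurable M"
  shows "(\<lambda>x. sketch enum l (A x) (v x)) \<in> borel_measurable M"
  unfolding sketch_def by measurable

lemma measurable_structured_fd:
  fixes enum :: "nat \<Rightarrow> 'd::finite"
  assumes f: "continuous_on UNIV f"
    and [measurable]: "A \<in> M \<rightarrow>\<^sub>M orthogonal_borel" "y \<in> borel_measurable M"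
  shows "(\<lambda>x. structured_fd enum l f (y x) (A x) \<beta>) \<in> borel_measurable M"
proof -
  have [measurable]: "f \<in> borel_measurable borel" by (rule borel_measurable_continuous_onI[OF f])
  show ?thesis unfolding structured_fd_def by measurable
qed

lemma measurable_full_fd:
  assumes f: "continuous_on UNIV f" and [measurable]: "y \<in> borel_measurable M"
  shows "(\<lambda>x. full_fd enum f (y x) \<beta>) \<in> borel_measurable M"
proof -
  have [measurable]: "f \<in> borel_measurable borel" by (rule borel_measurable_continuous_onI[OF f])
  show ?thesis unfolding full_fd_def by measurable
qed

text \<open>The algorithm for a fixed realization \<open>z\<close> of the draws, indexed by outer iteration, inner
  iteration and batch position.\<close>

locale vr_szd_setting =
  fixes n l b m :: nat and enum :: "nat \<Rightarrow> 'd::finite"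
    and fs :: "nat \<Rightarrow> real ^ 'd \<Rightarrow> real" and h :: "real ^ 'd \<Rightarrow> ereal"
    and L \<gamma> :: real and \<beta> :: "nat \<Rightarrow> real" and x00 :: "real ^ 'd"
  assumes enum: "bij_betw enum {1..CARD('d)} UNIV"
    and n: "n \<ge> 1" and l: "1 \<le> l" "l \<le> CARD('d)" and b: "b \<ge> 1"
    and smooth: "\<And>i. i \<in> {1..n} \<Longrightarrow> smooth_with L (fs i)"
    and convex: "convex_ext h" and proximable: "proximable h"
    and L: "L > 0" and \<gamma>: "\<gamma> > 0" and \<beta>: "\<And>\<tau>. \<beta> \<tau> > 0"
begin

abbreviation "f \<equiv> finite_sum n fs"

lemma smooth_f: "smooth_with L f"
  using smooth_with_finite_sum[OF n smooth] .

lemma enum_inj: "inj_on enum {1..l}"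
  using enum l by (auto simp: bij_betw_def intro: inj_on_subset)

definition direction :: "nat \<Rightarrow> (nat \<Rightarrow> nat \<times> (real ^ 'd ^ 'd)) \<Rightarrow> real ^ 'd \<Rightarrow> real ^ 'd \<Rightarrow> real ^ 'd" where
  "direction \<tau> y x x0 = vr_direction enum n fs l b (\<beta> \<tau>) (\<lambda>j. fst (y j)) (\<lambda>j. snd (y j)) x x0"

definition run :: "(nat \<times> nat \<times> nat \<Rightarrow> nat \<times> (real ^ 'd ^ 'd)) \<Rightarrow> nat \<Rightarrow> nat \<Rightarrow> real ^ 'd" where
  "run z \<tau> k = vr_szd enum n fs h l b m \<gamma> \<beta> x00
     (\<lambda>\<tau> k j. fst (z (\<tau>, k, j))) (\<lambda>\<tau> k j. snd (z (\<tau>, k, j))) \<tau> k"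

lemma run_simps:
  "run z 0 0 = x00"
  "run z (Suc \<tau>) 0 = run z \<tau> m"
  "run z \<tau> (Suc k) = prox \<gamma> h (run z \<tau> k - \<gamma> *\<^sub>R direction \<tau> (\<lambda>j. z (\<tau>, k, j)) (run z \<tau> k) (run z \<tau> 0))"
  by (simp_all add: run_def direction_def)

text \<open>The recursion pattern of the algorithm: the step case needs the current iterate and the anchor of
  the same epoch.\<close>

lemma run_induct [case_names start epoch step]:
  assumes "P 0 0" and "\<And>\<tau>. P \<tau> m \<Longrightarrow> P (Suc \<tau>) 0"
    and step: "\<And>\<tau> k. P \<tau> k \<Longrightarrow> P \<tau> 0 \<Longrightarrow> P \<tau> (Suc k)"
  shows "P \<tau> k"
proof -
  have inner: "P \<tau> k" if "P \<tau> 0" for \<tau> k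
    using that step by (induction k) auto
  have "P \<tau> 0"
    using assms(1,2) inner by (induction \<tau>) auto
  then show ?thesis by (rule inner)
qed

text \<open>The positions of the draws on which \<open>run z \<tau> k\<close> depends.\<close>

definition past :: "nat \<Rightarrow> nat \<Rightarrow> (nat \<times> nat \<times> nat) set" where
  "past \<tau> k = {(\<tau>', k', j). j \<in> {1..b} \<and> (\<tau>' < \<tau> \<and> k' < m \<or> \<tau>' = \<tau> \<and> k' < k)}"

lemma past_simps:
  "past \<tau> m \<subseteq> past (Suc \<tau>) 0" "past \<tau> k \<subseteq> past \<tau> (Suc k)" "past \<tau> 0 \<subseteq> past \<tau> k"
  "j \<in> {1..b} \<Longrightarrow> (\<tau>, k, j) \<in> past \<tau> (Suc k)"
  by (auto simp: past_def)

lemma run_cong: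
  assumes "\<And>p. p \<in> past \<tau> k \<Longrightarrow> z p = z' p"
  shows "run z \<tau> k = run z' \<tau> k"
  using assms
proof (induction \<tau> k rule: run_induct)
  case (epoch \<tau>)
  then have "run z \<tau> m = run z' \<tau> m" using past_simps(1) by (meson subsetD)
  then show ?case by (simp only: run_simps)
next
  case (step \<tau> k)
  have "direction \<tau> (\<lambda>j. z (\<tau>, k, j)) x x0 = direction \<tau> (\<lambda>j. z' (\<tau>, k, j)) x x0" for x x0
    using step.prems past_simps(4) by (simp add: direction_def vr_direction_def)
  moreover have "run z \<tau> k = run z' \<tau> k" "run z \<tau> 0 = run z' \<tau> 0"
    using step past_simps(2,3) by (meson subsetD)+
  ultimately show ?case by (simp only: run_simps)
qed (simp add: run_simps)

lemma measurable_direction: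
  assumes y: "\<And>j. j \<in> {1..b} \<Longrightarrow> (\<lambda>\<omega>. y \<omega> j) \<in> N \<rightarrow>\<^sub>M draw_space n"
    and x: "x \<in> borel_measurable N" "x0 \<in> borel_measurable N"
  shows "(\<lambda>\<omega>. direction \<tau> (y \<omega>) (x \<omega>) (x0 \<omega>)) \<in> borel_measurable N"
proof -
  have sfd: "(\<lambda>\<omega>. structured_fd enum l (fs (fst (y \<omega> j))) (x' \<omega>) (snd (y \<omega> j)) (\<beta> \<tau>)) \<in> borel_measurable N"
    if j: "j \<in> {1..b}" and x': "x' \<in> borel_measurable N" for j x'
  proof (rule measurable_compose_countable'[where I="{1..n}"
        and f="\<lambda>i \<omega>. structured_fd enum l (fs i) (x' \<omega>) (snd (y \<omega> j)) (\<beta> \<tau>)"])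
    show "(\<lambda>\<omega>. structured_fd enum l (fs i) (x' \<omega>) (snd (y \<omega> j)) (\<beta> \<tau>)) \<in> borel_measurable N"
      if "i \<in> {1..n}" for i
      by (intro measurable_structured_fd x' smooth_with_continuous(1)[OF smooth[OF that]]
          measurable_compose[OF y[OF j] measurable_snd])
    show "(\<lambda>\<omega>. fst (y \<omega> j)) \<in> N \<rightarrow>\<^sub>M count_space {1..n}"
      by (rule measurable_compose[OF y[OF j] measurable_fst])
  qed simp
  show ?thesis
    unfolding direction_def vr_direction_def
    by (intro borel_measurable_add borel_measurable_scaleR borel_measurable_const borel_measurable_sum
        borel_measurable_diff sfd x measurable_full_fd smooth_with_continuous(1)[OF smooth_f]) auto
qed

lemma measurable_run:
  assumes "past \<tau> k \<subseteq> B"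
  shows "(\<lambda>z. run z \<tau> k) \<in> borel_measurable (PiM B (\<lambda>_. draw_space n))"
  using assms
proof (induction \<tau> k rule: run_induct)
  case (epoch \<tau>)
  then show ?case using past_simps(1)[of \<tau>] by (simp add: run_simps)
next
  case (step \<tau> k)
  have IH: "(\<lambda>z. run z \<tau> k) \<in> borel_measurable (PiM B (\<lambda>_. draw_space n))"
    "(\<lambda>z. run z \<tau> 0) \<in> borel_measurable (PiM B (\<lambda>_. draw_space n))"
    using step past_simps(2,3) by (meson order_trans)+
  have draws: "(\<lambda>z. z (\<tau>, k, j)) \<in> PiM B (\<lambda>_. draw_space n) \<rightarrow>\<^sub>M draw_space n" if "j \<in> {1..b}" for j
    using step.prems past_simps(4)[OF that] by (intro measurable_component_singleton) auto
  show ?case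
    unfolding run_simps
    by (rule measurable_compose[OF _ borel_measurable_continuous_onI[OF continuous_prox[OF convex proximable \<gamma>]]])
       (intro borel_measurable_diff borel_measurable_scaleR borel_measurable_const measurable_direction IH draws)
qed (simp add: run_simps)

lemma direction_error:
  assumes "\<And>j. j \<in> {1..b} \<Longrightarrow> y j \<in> space (draw_space n)"
  shows "(norm (direction \<tau> y x x0 - gradient f x))\<^sup>2
    \<le> 2 * (norm ((1 / real b) *\<^sub>R (\<Sum>j = 1..b. fluctuation enum l n fs (y j) (x, x0))))\<^sup>2
      + (4 * (real CARD('d))\<^sup>2 + real CARD('d)) * L\<^sup>2 * (\<beta> \<tau>)\<^sup>2"
proof -
  have "fst (y j) \<in> {1..n}" "orthogonal_matrix (snd (y j))" if "j \<in> {1..b}" for j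
    using assms[OF that] unfolding space_draw_space by auto
  then show ?thesis
    using vr_direction_error[OF enum l b smooth_f, of "\<lambda>j. fst (y j)" "\<lambda>j. snd (y j)" "\<beta> \<tau>" x x0]
      smooth \<beta>[of \<tau>] L by (simp add: direction_def)
qed

lemma fluctuation_le:
  assumes "y \<in> space (draw_space n)"
  shows "norm (fluctuation enum l n fs y (x, x0)) \<le> (real CARD('d) / real l + 1) * (L * norm (x - x0))"
  using assms norm_fluctuation_le[OF enum_inj smooth_f, of "fst y" "snd y" x x0] smooth
  unfolding space_draw_space by auto

lemma mean_fluctuation_le:
  assumes "\<And>j. j \<in> {1..b} \<Longrightarrow> y j \<in> space (draw_space n)"
  shows "norm ((1 / real b) *\<^sub>R (\<Sum>j = 1..b. fluctuation enum l n fs (y j) (x, x0)))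
    \<le> (real CARD('d) / real l + 1) * (L * norm (x - x0))"
proof -
  have "norm ((1 / real b) *\<^sub>R (\<Sum>j = 1..b. fluctuation enum l n fs (y j) (x, x0)))
      \<le> 1 / real b * (\<Sum>j = 1..b. (real CARD('d) / real l + 1) * (L * norm (x - x0)))"
    unfolding norm_scaleR using fluctuation_le[OF assms]
    by (intro mult_mono sum_norm_le) (auto intro: sum_nonneg)
  then show ?thesis using b by simp
qed

text \<open>The error of the search direction is bounded uniformly over the draws as long as the iterate and
  the anchor stay in a ball, gradients grow linearly and proximal maps are nonexpansive; so the
  radius of a ball containing all possible iterates grows in a controlled way from step to step. This
  makes the expectations below finite.\<close>

lemma run_bounded:
  "\<exists>C\<ge>0. \<forall>z. (\<forall>p\<in>past \<tau> k. z p \<in> space (draw_space n)) \<longrightarrow> norm (run z \<tau> k) \<le> C"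
proof (induction \<tau> k rule: run_induct)
  case start
  show ?case by (rule exI[of _ "norm x00"]) (simp add: run_simps)
next
  case (epoch \<tau>)
  then show ?case using past_simps(1)[of \<tau>] unfolding run_simps by blast
next
  case (step \<tau> k)
  obtain C1 where C1: "\<And>z. \<forall>p\<in>past \<tau> k. z p \<in> space (draw_space n) \<Longrightarrow> norm (run z \<tau> k) \<le> C1"
    using step by blast
  obtain C2 where C2: "\<And>z. \<forall>p\<in>past \<tau> 0. z p \<in> space (draw_space n) \<Longrightarrow> norm (run z \<tau> 0) \<le> C2"
    using step by blast
  define E where "E = sqrt (2 * ((real CARD('d) / real l + 1) * (L * (C1 + C2)))\<^sup>2
      + (4 * (real CARD('d))\<^sup>2 + real CARD('d)) * L\<^sup>2 * (\<beta> \<tau>)\<^sup>2)"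
  define C where "C = norm (prox \<gamma> h 0) + (C1 + \<gamma> * (E + (norm (gradient f 0) + L * C1)))"
  have bound: "norm (run z \<tau> (Suc k)) \<le> C" if z: "\<forall>p\<in>past \<tau> (Suc k). z p \<in> space (draw_space n)" for z
  proof -
    define x x0 y where "x = run z \<tau> k" and "x0 = run z \<tau> 0" and "y = (\<lambda>j. z (\<tau>, k, j))"
    have x: "norm x \<le> C1" unfolding x_def using z past_simps(2) by (intro C1) blast
    have x0: "norm x0 \<le> C2" unfolding x0_def using z past_simps(3) by (intro C2) blast
    have y: "y j \<in> space (draw_space n)" if "j \<in> {1..b}" for j
      unfolding y_def using z past_simps(4)[OF that] by blast
    have dist: "norm (x - x0) \<le> C1 + C2"
      using x x0 norm_triangle_ineq4[of x x0] by linarith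
    have "(norm (direction \<tau> y x x0 - gradient f x))\<^sup>2
        \<le> 2 * ((real CARD('d) / real l + 1) * (L * (C1 + C2)))\<^sup>2
          + (4 * (real CARD('d))\<^sup>2 + real CARD('d)) * L\<^sup>2 * (\<beta> \<tau>)\<^sup>2"
      using L dist
      by (intro order_trans[OF direction_error[OF y]] add_right_mono mult_left_mono power_mono
          order_trans[OF mean_fluctuation_le[OF y]]) auto
    then have E: "norm (direction \<tau> y x x0 - gradient f x) \<le> E"
      unfolding E_def by (rule real_le_rsqrt)
    have "norm (gradient f x - gradient f 0) \<le> L * norm (x - 0)"
      using smooth_f unfolding smooth_with_def by blast
    also have "\<dots> \<le> L * C1" using x L by simp
    finally have g: "norm (gradient f x) \<le> norm (gradient f 0) + L * C1"
      using norm_triangle_sub[of "gradient f x" "gradient f 0"] by linarith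
    have "norm (direction \<tau> y x x0) \<le> E + (norm (gradient f 0) + L * C1)"
      using E g norm_triangle_sub[of "direction \<tau> y x x0" "gradient f x"] by linarith
    then have "norm (x - \<gamma> *\<^sub>R direction \<tau> y x x0) \<le> C1 + \<gamma> * (E + (norm (gradient f 0) + L * C1))"
      using x \<gamma> by (intro order_trans[OF norm_triangle_ineq4] add_mono) (auto intro: mult_left_mono)
    moreover have "norm (run z \<tau> (Suc k)) \<le> norm (prox \<gamma> h 0) + norm (x - \<gamma> *\<^sub>R direction \<tau> y x x0)"
      unfolding run_simps x_def[symmetric] x0_def[symmetric] y_def[symmetric]
      using prox_nonexpansive[OF convex proximable \<gamma>, of "x - \<gamma> *\<^sub>R direction \<tau> y x x0" 0]
        norm_triangle_sub[of "prox \<gamma> h (x - \<gamma> *\<^sub>R direction \<tau> y x x0)" "prox \<gamma> h 0"] by simp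
    ultimately show ?thesis unfolding C_def by linarith
  qed
  show ?case by (rule exI[of _ "max C 0"]) (use bound in force)
qed

end

section \<open>The descent along one trajectory\<close>

context vr_szd_setting
begin

text \<open>Since \<open>real_of_ereal\<close> sends infinite values to \<open>0\<close>, this is the objective on the domain of \<open>h\<close>
  only.\<close>

definition potential :: "real ^ 'd \<Rightarrow> real" where
  "potential x = f x + real_of_ereal (h x)"

definition mean_fluctuation :: "(nat \<times> nat \<times> nat \<Rightarrow> nat \<times> (real ^ 'd ^ 'd)) \<Rightarrow> nat \<Rightarrow> nat \<Rightarrow> real ^ 'd" where
  "mean_fluctuation z \<tau> k =
     (1 / real b) *\<^sub>R (\<Sum>j = 1..b. fluctuation enum l n fs (z (\<tau>, k, j)) (run z \<tau> k, run z \<tau> 0))"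

text \<open>Proximal points lie in the domain of \<open>h\<close>, so only the starting point could fall outside it.\<close>

lemma run_finite:
  assumes "\<bar>h x00\<bar> \<noteq> \<infinity>"
  shows "\<bar>h (run z \<tau> k)\<bar> \<noteq> \<infinity>"
  by (induction \<tau> k rule: run_induct)
     (use assms prox_finite[OF convex proximable \<gamma>] in \<open>simp_all add: run_simps\<close>)

lemma run_descent:
  assumes h00: "\<bar>h x00\<bar> \<noteq> \<infinity>" and z: "\<And>j. j \<in> {1..b} \<Longrightarrow> z (\<tau>, k, j) \<in> space (draw_space n)"
  shows "\<gamma> / 2 * (norm (gradient_mapping \<gamma> f h (run z \<tau> k)))\<^sup>2
      \<le> potential (run z \<tau> k) - potential (run z \<tau> (Suc k))
        - (1 / (2 * \<gamma>) - L / 2) * (norm (run z \<tau> (Suc k) - run z \<tau> k))\<^sup>2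
        + \<gamma> * (norm (mean_fluctuation z \<tau> k))\<^sup>2
        + \<gamma> / 2 * ((4 * (real CARD('d))\<^sup>2 + real CARD('d)) * L\<^sup>2 * (\<beta> \<tau>)\<^sup>2)"
proof -
  define E where "E = (4 * (real CARD('d))\<^sup>2 + real CARD('d)) * L\<^sup>2 * (\<beta> \<tau>)\<^sup>2"
  define v where "v = direction \<tau> (\<lambda>j. z (\<tau>, k, j)) (run z \<tau> k) (run z \<tau> 0)"
  have "(norm (v - gradient f (run z \<tau> k)))\<^sup>2 \<le> 2 * (norm (mean_fluctuation z \<tau> k))\<^sup>2 + E"
    unfolding v_def mean_fluctuation_def E_def by (rule direction_error[OF z])
  then have "\<gamma> / 2 * (norm (v - gradient f (run z \<tau> k)))\<^sup>2
      \<le> \<gamma> / 2 * (2 * (norm (mean_fluctuation z \<tau> k))\<^sup>2 + E)"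
    using \<gamma> by (intro mult_left_mono) auto
  also have "\<dots> = \<gamma> * (norm (mean_fluctuation z \<tau> k))\<^sup>2 + \<gamma> / 2 * E"
    by (simp add: distrib_left)
  finally show ?thesis
    using prox_gradient_descent[OF convex proximable \<gamma> smooth_f run_finite[OF h00]
        run_simps(3)[of z \<tau> k, folded v_def]]
    unfolding potential_def E_def by simp
qed

text \<open>The second stepsize condition bounds \<open>\<gamma> c m\<^sup>2 / 2\<close>, where \<open>c = d L\<^sup>2 / (l b)\<close>, by \<open>1 / (64 \<gamma>)\<close>, and the
  first one gives \<open>1 / (2 \<gamma>) - L / 2 \<ge> 3 / (8 \<gamma>)\<close>. Hence the squared steps dominate \<open>\<gamma> c\<close> times the
  squared distances to the anchor. These are subtracted from the squared fluctuations, since they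
  bound them in mean.\<close>

lemma epoch_descent:
  assumes h00: "\<bar>h x00\<bar> \<noteq> \<infinity>"
    and z: "\<And>k j. k < m \<Longrightarrow> j \<in> {1..b} \<Longrightarrow> z (\<tau>, k, j) \<in> space (draw_space n)"
    and step: "L * \<gamma> \<le> 1 / 4" "32 * \<gamma>\<^sup>2 * L\<^sup>2 * (real m)\<^sup>2 * real CARD('d) \<le> real l * real b"
  shows "(\<Sum>k<m. \<gamma> / 2 * (norm (gradient_mapping \<gamma> f h (run z \<tau> k)))\<^sup>2)
      \<le> potential (run z \<tau> 0) - potential (run z \<tau> m)
        + (\<Sum>k<m. \<gamma> * ((norm (mean_fluctuation z \<tau> k))\<^sup>2
            - real CARD('d) * L\<^sup>2 / (real l * real b) * (norm (run z \<tau> k - run z \<tau> 0))\<^sup>2))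
        + \<gamma> / 2 * real m * ((4 * (real CARD('d))\<^sup>2 + real CARD('d)) * L\<^sup>2 * (\<beta> \<tau>)\<^sup>2)"
proof -
  define E where "E = (4 * (real CARD('d))\<^sup>2 + real CARD('d)) * L\<^sup>2 * (\<beta> \<tau>)\<^sup>2"
  define a where "a = 1 / (2 * \<gamma>) - L / 2"
  define c where "c = real CARD('d) * L\<^sup>2 / (real l * real b)"
  define S where "S = (\<Sum>k<m. (norm (run z \<tau> (Suc k) - run z \<tau> k))\<^sup>2)"
  have lb: "real l * real b > 0" using l b by simp
  have "S \<ge> 0" by (simp add: S_def sum_nonneg)
  have "\<gamma> * c * ((real m)\<^sup>2 / 2) \<le> a"
  proof -
    have "\<gamma>\<^sup>2 * c * (real m)\<^sup>2 * 32 \<le> 1"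
      using step(2) lb by (simp add: c_def divide_le_eq mult_ac)
    then have "\<gamma> * (\<gamma> * c * ((real m)\<^sup>2 / 2)) \<le> \<gamma> * a"
      using step(1) \<gamma> by (simp add: a_def power2_eq_square right_diff_distrib mult_ac)
    then show ?thesis using \<gamma> by simp
  qed
  then have "\<gamma> * c * ((real m)\<^sup>2 / 2) * S \<le> a * S"
    using \<open>S \<ge> 0\<close> by (rule mult_right_mono)
  moreover have "\<gamma> * c * (\<Sum>k<m. (norm (run z \<tau> k - run z \<tau> 0))\<^sup>2) \<le> \<gamma> * c * ((real m)\<^sup>2 / 2 * S)"
    unfolding S_def using \<gamma> lb by (intro mult_left_mono sum_drift_le) (simp add: c_def)
  ultimately have drift: "\<gamma> * c * (\<Sum>k<m. (norm (run z \<tau> k - run z \<tau> 0))\<^sup>2) \<le> a * S"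
    by (simp add: mult.assoc)
  have "(\<Sum>k<m. \<gamma> / 2 * (norm (gradient_mapping \<gamma> f h (run z \<tau> k)))\<^sup>2)
      \<le> (\<Sum>k<m. (potential (run z \<tau> k) - potential (run z \<tau> (Suc k)))
        - a * (norm (run z \<tau> (Suc k) - run z \<tau> k))\<^sup>2
        + \<gamma> * (norm (mean_fluctuation z \<tau> k))\<^sup>2 + \<gamma> / 2 * E)"
    unfolding a_def E_def by (intro sum_mono run_descent h00 z) auto
  also have "\<dots> = (potential (run z \<tau> 0) - potential (run z \<tau> m)) - a * S
      + (\<Sum>k<m. \<gamma> * (norm (mean_fluctuation z \<tau> k))\<^sup>2) + \<gamma> / 2 * real m * E"
    using sum_lessThan_telescope'[of "\<lambda>k. potential (run z \<tau> k)" m]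
    by (simp add: sum.distrib sum_subtractf S_def sum_distrib_left mult_ac)
  also have "\<dots> \<le> (potential (run z \<tau> 0) - potential (run z \<tau> m))
      - \<gamma> * c * (\<Sum>k<m. (norm (run z \<tau> k - run z \<tau> 0))\<^sup>2)
      + (\<Sum>k<m. \<gamma> * (norm (mean_fluctuation z \<tau> k))\<^sup>2) + \<gamma> / 2 * real m * E"
    using drift by simp
  also have "\<dots> = potential (run z \<tau> 0) - potential (run z \<tau> m)
        + (\<Sum>k<m. \<gamma> * ((norm (mean_fluctuation z \<tau> k))\<^sup>2 - c * (norm (run z \<tau> k - run z \<tau> 0))\<^sup>2))
        + \<gamma> / 2 * real m * E"
    by (simp add: right_diff_distrib sum_subtractf sum_distrib_left mult.assoc)
  finally show ?thesis unfolding c_def E_def .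
qed

lemma trajectory_descent:
  assumes h00: "\<bar>h x00\<bar> \<noteq> \<infinity>"
    and z: "\<And>p. p \<in> {0..T} \<times> {0..<m} \<times> {1..b} \<Longrightarrow> z p \<in> space (draw_space n)"
    and step: "L * \<gamma> \<le> 1 / 4" "32 * \<gamma>\<^sup>2 * L\<^sup>2 * (real m)\<^sup>2 * real CARD('d) \<le> real l * real b"
    and lower: "\<And>x. \<bar>h x\<bar> \<noteq> \<infinity> \<Longrightarrow> F \<le> potential x"
  shows "(\<Sum>\<tau> = 0..T. \<Sum>k<m. \<gamma> / 2 * (norm (gradient_mapping \<gamma> f h (run z \<tau> k)))\<^sup>2)
      \<le> potential x00 - F
        + (\<Sum>\<tau> = 0..T. \<Sum>k<m. \<gamma> * ((norm (mean_fluctuation z \<tau> k))\<^sup>2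
            - real CARD('d) * L\<^sup>2 / (real l * real b) * (norm (run z \<tau> k - run z \<tau> 0))\<^sup>2))
        + \<gamma> / 2 * real m * ((4 * (real CARD('d))\<^sup>2 + real CARD('d)) * L\<^sup>2) * (\<Sum>\<tau> = 0..T. (\<beta> \<tau>)\<^sup>2)"
proof -
  define D where "D = (4 * (real CARD('d))\<^sup>2 + real CARD('d)) * L\<^sup>2"
  define A where "A \<tau> = (\<Sum>k<m. \<gamma> * ((norm (mean_fluctuation z \<tau> k))\<^sup>2
            - real CARD('d) * L\<^sup>2 / (real l * real b) * (norm (run z \<tau> k - run z \<tau> 0))\<^sup>2))" for \<tau>
  have "(\<Sum>\<tau> = 0..T. \<Sum>k<m. \<gamma> / 2 * (norm (gradient_mapping \<gamma> f h (run z \<tau> k)))\<^sup>2)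
      \<le> (\<Sum>\<tau> = 0..T. (potential (run z \<tau> 0) - potential (run z (Suc \<tau>) 0)) + A \<tau>
          + \<gamma> / 2 * real m * (D * (\<beta> \<tau>)\<^sup>2))"
    unfolding A_def D_def run_simps(2) by (intro sum_mono epoch_descent h00 step z) auto
  also have "\<dots> = (potential x00 - potential (run z (Suc T) 0)) + (\<Sum>\<tau> = 0..T. A \<tau>)
      + \<gamma> / 2 * real m * D * (\<Sum>\<tau> = 0..T. (\<beta> \<tau>)\<^sup>2)"
    using sum_lessThan_telescope'[of "\<lambda>\<tau>. potential (run z \<tau> 0)" "Suc T"]
    by (simp add: sum.distrib sum_distrib_left mult.assoc atLeast0AtMost lessThan_Suc_atMost run_simps(1))
  finally show ?thesis
    using lower[OF run_finite[OF h00, of z "Suc T" 0]] unfolding A_def D_def by linarith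
qed

end

section \<open>The second moment of the fluctuation\<close>

locale vr_szd_draws = vr_szd_setting n l b m enum fs h L \<gamma> \<beta> x00 + haar: haar_orthogonal \<mu>
  for n l b m :: nat and enum :: "nat \<Rightarrow> 'd::finite"
    and fs :: "nat \<Rightarrow> real ^ 'd \<Rightarrow> real" and h :: "real ^ 'd \<Rightarrow> ereal"
    and L \<gamma> :: real and \<beta> :: "nat \<Rightarrow> real" and x00 :: "real ^ 'd"
    and \<mu> :: "(real ^ 'd ^ 'd) measure"
begin

abbreviation draw :: "(nat \<times> (real ^ 'd ^ 'd)) measure" where
  "draw \<equiv> uniform_count_measure {1..n} \<Otimes>\<^sub>M \<mu>"

lemma sets_draw: "sets draw = sets (draw_space n)"
  by (intro sets_pair_measure_cong haar.sets_haar sets_uniform_count_measure_count_space)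

lemma integral_draw:
  fixes \<phi> :: "nat \<times> (real ^ 'd ^ 'd) \<Rightarrow> real"
  assumes \<phi>: "\<phi> \<in> borel_measurable (draw_space n)"
    and bounded: "\<And>y. y \<in> space (draw_space n) \<Longrightarrow> \<bar>\<phi> y\<bar> \<le> C"
  shows "(\<integral>y. \<phi> y \<partial>draw) = (1 / real n) * (\<Sum>i = 1..n. \<integral>G. \<phi> (i, G) \<partial>\<mu>)"
proof -
  interpret U: prob_space "uniform_count_measure {1..n}"
    using n by (intro prob_space_uniform_count_measure) auto
  interpret P: pair_prob_space "uniform_count_measure {1..n}" \<mu> ..
  have "integrable draw \<phi>"
  proof (rule P.integrable_const_bound)
    show "AE y in draw. norm (\<phi> y) \<le> C"
      using bounded sets_eq_imp_space_eq[OF sets_draw] by (intro AE_I2) simp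
    show "\<phi> \<in> borel_measurable draw"
      using \<phi> by (simp add: measurable_cong_sets[OF sets_draw refl])
  qed
  from P.integral_fst'[OF this]
  show ?thesis by (simp add: integral_uniform_count_measure)
qed

lemma measurable_fluctuation:
  "(\<lambda>(w, y). fluctuation enum l n fs y w) \<in> borel_measurable ((borel \<Otimes>\<^sub>M borel) \<Otimes>\<^sub>M draw_space n)"
proof -
  let ?N = "((borel \<Otimes>\<^sub>M borel) \<Otimes>\<^sub>M draw_space n) :: (((real ^ 'd) \<times> (real ^ 'd)) \<times> (nat \<times> (real ^ 'd ^ 'd))) measure"
  define \<phi> where "\<phi> i p = sketch enum l (snd (snd p)) (gradient (fs i) (fst (fst p)) - gradient (fs i) (snd (fst p)))
      - (gradient f (fst (fst p)) - gradient f (snd (fst p)))" for i and p :: "((real ^ 'd) \<times> (real ^ 'd)) \<times> (nat \<times> (real ^ 'd ^ 'd))"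
  have [measurable]: "gradient f \<in> borel_measurable borel"
    by (rule borel_measurable_continuous_onI[OF smooth_with_continuous(2)[OF smooth_f]])
  have "(\<lambda>p. \<phi> (fst (snd p)) p) \<in> borel_measurable ?N"
  proof (rule measurable_compose_countable'[where I="{1..n}"])
    fix i assume "i \<in> {1..n}"
    then have [measurable]: "gradient (fs i) \<in> borel_measurable borel"
      by (intro borel_measurable_continuous_onI smooth_with_continuous(2)[OF smooth])
    show "\<phi> i \<in> borel_measurable ?N"
      unfolding \<phi>_def by (intro borel_measurable_diff measurable_sketch) measurable
  qed auto
  then show ?thesis
    by (simp add: \<phi>_def fluctuation_def case_prod_unfold)
qed

lemma measurable_fluctuation_draw:
  "(\<lambda>y. fluctuation enum l n fs y w) \<in> borel_measurable (draw_space n)"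
  using measurable_compose[OF measurable_Pair1' measurable_fluctuation, of w]
  by (simp add: space_pair_measure)

text \<open>The sketch reproduces \<open>\<nabla>f\<^sub>i(x) - \<nabla>f\<^sub>i(x\<^sub>0)\<close> in mean over \<open>G\<close>, and the mean of that over \<open>i\<close> is
  subtracted in the definition of the fluctuation.\<close>

lemma integral_fluctuation:
  "(\<integral>y. inner u (fluctuation enum l n fs y w) \<partial>draw) = 0"
proof -
  obtain x x0 where w: "w = (x, x0)" by (cases w)
  define \<delta> where "\<delta> i = gradient (fs i) x - gradient (fs i) x0" for i
  define \<delta>f where "\<delta>f = gradient f x - gradient f x0"
  have \<delta>f: "\<delta>f = (1 / real n) *\<^sub>R (\<Sum>i = 1..n. \<delta> i)"
    using smooth unfolding \<delta>f_def \<delta>_def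
    by (subst (1 2) gradient_finite_sum(2)) (auto simp: smooth_with_def sum_subtractf scaleR_diff_right)
  have "(\<integral>y. inner u (fluctuation enum l n fs y w) \<partial>draw)
      = (1 / real n) * (\<Sum>i = 1..n. \<integral>G. inner u (fluctuation enum l n fs (i, G) w) \<partial>\<mu>)"
  proof (rule integral_draw)
    show "(\<lambda>y. inner u (fluctuation enum l n fs y w)) \<in> borel_measurable (draw_space n)"
      by (intro borel_measurable_inner borel_measurable_const measurable_fluctuation_draw)
    fix y :: "nat \<times> (real ^ 'd ^ 'd)" assume "y \<in> space (draw_space n)"
    then show "\<bar>inner u (fluctuation enum l n fs y w)\<bar>
        \<le> norm u * ((real CARD('d) / real l + 1) * (L * norm (x - x0)))"
      unfolding w by (intro order_trans[OF Cauchy_Schwarz_ineq2] mult_left_mono fluctuation_le) auto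
  qed
  also have "\<dots> = (1 / real n) * (\<Sum>i = 1..n. inner u (\<delta> i) - inner u \<delta>f)"
    using haar.expectation_inner_sketch[OF l(1)] haar.prob_space
    by (simp add: w fluctuation_def inner_diff_right flip: \<delta>_def \<delta>f_def)
  also have "\<dots> = 0"
    using n by (simp add: \<delta>f inner_sum_right sum_subtractf)
  finally show ?thesis .
qed

text \<open>A variance is at most the uncentred second moment, which is \<open>d / l\<close> times the mean of
  \<open>\<parallel>\<nabla>f\<^sub>i(x) - \<nabla>f\<^sub>i(x\<^sub>0)\<parallel>\<^sup>2\<close>.\<close>

lemma integral_norm_fluctuation_le:
  "(\<integral>y. (norm (fluctuation enum l n fs y w))\<^sup>2 \<partial>draw)
     \<le> real CARD('d) * L\<^sup>2 / real l * (norm (fst w - snd w))\<^sup>2"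
proof -
  obtain x x0 where w: "w = (x, x0)" by (cases w)
  define \<delta> where "\<delta> i = gradient (fs i) x - gradient (fs i) x0" for i
  define \<delta>f where "\<delta>f = gradient f x - gradient f x0"
  have \<delta>f: "\<delta>f = (1 / real n) *\<^sub>R (\<Sum>i = 1..n. \<delta> i)"
    using smooth unfolding \<delta>f_def \<delta>_def
    by (subst (1 2) gradient_finite_sum(2)) (auto simp: smooth_with_def sum_subtractf scaleR_diff_right)
  have expand: "(norm (sketch enum l G v - u))\<^sup>2
      = (norm (sketch enum l G v))\<^sup>2 - 2 * inner u (sketch enum l G v) + (norm u)\<^sup>2" for G v u
    by (simp add: power2_norm_eq_inner inner_diff_left inner_diff_right inner_commute del: norm_eq_sqrt_inner)
  have "(\<integral>y. (norm (fluctuation enum l n fs y w))\<^sup>2 \<partial>draw)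
      = (1 / real n) * (\<Sum>i = 1..n. \<integral>G. (norm (fluctuation enum l n fs (i, G) w))\<^sup>2 \<partial>\<mu>)"
  proof (rule integral_draw)
    show "(\<lambda>y. (norm (fluctuation enum l n fs y w))\<^sup>2) \<in> borel_measurable (draw_space n)"
      by (intro borel_measurable_power measurable_compose[OF measurable_fluctuation_draw borel_measurable_norm])
    fix y :: "nat \<times> (real ^ 'd ^ 'd)" assume "y \<in> space (draw_space n)"
    then show "\<bar>(norm (fluctuation enum l n fs y w))\<^sup>2\<bar>
        \<le> ((real CARD('d) / real l + 1) * (L * norm (x - x0)))\<^sup>2"
      unfolding w abs_power2 by (intro power_mono fluctuation_le) auto
  qed
  also have "\<dots> = (1 / real n) * (\<Sum>i = 1..n. real CARD('d) / real l * (norm (\<delta> i))\<^sup>2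
      - 2 * inner \<delta>f (\<delta> i) + (norm \<delta>f)\<^sup>2)"
    using haar.expectation_inner_sketch[OF l(1)] haar.expectation_norm_sketch[OF l(1) enum_inj] haar.prob_space
    by (simp add: w fluctuation_def expand flip: \<delta>_def \<delta>f_def)
  also have "\<dots> = (1 / real n) * (\<Sum>i = 1..n. real CARD('d) / real l * (norm (\<delta> i))\<^sup>2) - (norm \<delta>f)\<^sup>2"
  proof -
    have "(1 / real n) * (\<Sum>i = 1..n. 2 * inner \<delta>f (\<delta> i)) = 2 * inner \<delta>f \<delta>f"
      by (subst (3) \<delta>f) (simp add: inner_sum_right sum_distrib_left)
    then show ?thesis
      using n by (simp add: sum.distrib sum_subtractf distrib_left right_diff_distrib power2_norm_eq_inner
          del: norm_eq_sqrt_inner)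
  qed
  also have "\<dots> \<le> (1 / real n) * (\<Sum>i = 1..n. real CARD('d) / real l * (L * norm (x - x0))\<^sup>2)"
  proof -
    have "norm (\<delta> i) \<le> L * norm (x - x0)" if "i \<in> {1..n}" for i
      using smooth[OF that] by (simp add: \<delta>_def smooth_with_def)
    then have "(1 / real n) * (\<Sum>i = 1..n. real CARD('d) / real l * (norm (\<delta> i))\<^sup>2)
        \<le> (1 / real n) * (\<Sum>i = 1..n. real CARD('d) / real l * (L * norm (x - x0))\<^sup>2)"
      by (intro mult_left_mono sum_mono power_mono) auto
    then show ?thesis using zero_le_power2[of "norm \<delta>f"] by linarith
  qed
  also have "\<dots> = real CARD('d) * L\<^sup>2 / real l * (norm (fst w - snd w))\<^sup>2"
    using n by (simp add: w power_mult_distrib)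
  finally show ?thesis .
qed

end

section \<open>Expectations along the random trajectory\<close>

lemma (in prob_space) expectation_double_sum:
  fixes \<phi> :: "'i \<Rightarrow> 'j \<Rightarrow> 'a \<Rightarrow> real"
  assumes "\<And>i j. i \<in> I \<Longrightarrow> j \<in> J \<Longrightarrow> integrable M (\<phi> i j)"
  shows "integrable M (\<lambda>\<omega>. \<Sum>i\<in>I. \<Sum>j\<in>J. \<phi> i j \<omega>)"
    and "expectation (\<lambda>\<omega>. \<Sum>i\<in>I. \<Sum>j\<in>J. \<phi> i j \<omega>) = (\<Sum>i\<in>I. \<Sum>j\<in>J. expectation (\<phi> i j))"
proof -
  have int: "integrable M (\<lambda>\<omega>. \<Sum>j\<in>J. \<phi> i j \<omega>)" if "i \<in> I" for i
    using assms that by (intro Bochner_Integration.integrable_sum)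
  then show "integrable M (\<lambda>\<omega>. \<Sum>i\<in>I. \<Sum>j\<in>J. \<phi> i j \<omega>)"
    by (rule Bochner_Integration.integrable_sum)
  have "expectation (\<lambda>\<omega>. \<Sum>i\<in>I. \<Sum>j\<in>J. \<phi> i j \<omega>) = (\<Sum>i\<in>I. expectation (\<lambda>\<omega>. \<Sum>j\<in>J. \<phi> i j \<omega>))"
    using int by (rule Bochner_Integration.integral_sum)
  also have "\<dots> = (\<Sum>i\<in>I. \<Sum>j\<in>J. expectation (\<phi> i j))"
    using assms by (intro sum.cong refl Bochner_Integration.integral_sum)
  finally show "expectation (\<lambda>\<omega>. \<Sum>i\<in>I. \<Sum>j\<in>J. \<phi> i j \<omega>) = (\<Sum>i\<in>I. \<Sum>j\<in>J. expectation (\<phi> i j))" .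
qed

locale vr_szd_process =
  vr_szd_draws n l b m enum fs h L \<gamma> \<beta> x00 \<mu> + prob_space M
  for n l b m :: nat and enum :: "nat \<Rightarrow> 'd::finite"
    and fs :: "nat \<Rightarrow> real ^ 'd \<Rightarrow> real" and h :: "real ^ 'd \<Rightarrow> ereal"
    and L \<gamma> :: real and \<beta> :: "nat \<Rightarrow> real" and x00 :: "real ^ 'd"
    and \<mu> :: "(real ^ 'd ^ 'd) measure" and M :: "'w measure" +
  fixes T :: nat and Z :: "nat \<times> nat \<times> nat \<Rightarrow> 'w \<Rightarrow> nat \<times> (real ^ 'd ^ 'd)"
  assumes indep: "indep_vars (\<lambda>_. draw_space n) Z ({0..T} \<times> {0..<m} \<times> {1..b})"
    and law: "\<And>p. p \<in> {0..T} \<times> {0..<m} \<times> {1..b} \<Longrightarrow> distr M (draw_space n) (Z p) = draw"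
begin

abbreviation "draws \<equiv> {0..T} \<times> {0..<m} \<times> {1..b}"

definition X :: "nat \<Rightarrow> nat \<Rightarrow> 'w \<Rightarrow> real ^ 'd" where
  "X \<tau> k \<omega> = run (\<lambda>p. Z p \<omega>) \<tau> k"

lemma past_subset: "\<tau> \<le> T \<Longrightarrow> k \<le> m \<Longrightarrow> past \<tau> k \<subseteq> draws"
  by (auto simp: past_def)

lemma random_draw: "p \<in> draws \<Longrightarrow> random_variable (draw_space n) (Z p)"
  using indep unfolding indep_vars_def by blast

lemma draw_in_space: "p \<in> draws \<Longrightarrow> \<omega> \<in> space M \<Longrightarrow> Z p \<omega> \<in> space (draw_space n)"
  using measurable_space[OF random_draw] .

lemma X_restrict: "past \<tau> k \<subseteq> B \<Longrightarrow> run (restrict (\<lambda>p. Z p \<omega>) B) \<tau> k = X \<tau> k \<omega>"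
  unfolding X_def by (rule run_cong) auto

lemma random_X: 
  assumes "\<tau> \<le> T" "k \<le> m"
  shows "random_variable borel (X \<tau> k)"
proof -
  have "(\<lambda>\<omega>. restrict (\<lambda>p. Z p \<omega>) draws) \<in> M \<rightarrow>\<^sub>M PiM draws (\<lambda>_. draw_space n)"
    by (intro measurable_restrict random_draw)
  from measurable_compose[OF this measurable_run[OF past_subset[OF assms]]]
  show ?thesis unfolding X_restrict[OF past_subset[OF assms]] .
qed

lemma X_bounded:
  assumes "\<tau> \<le> T" "k \<le> m"
  obtains C where "\<And>\<omega>. \<omega> \<in> space M \<Longrightarrow> norm (X \<tau> k \<omega>) \<le> C"
proof -
  obtain C where C: "\<And>z. \<forall>p\<in>past \<tau> k. z p \<in> space (draw_space n) \<Longrightarrow> norm (run z \<tau> k) \<le> C"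
    using run_bounded by blast
  show thesis
    using past_subset[OF assms] draw_in_space by (intro that[of C]) (auto simp: X_def intro!: C)
qed

lemma integrable_continuous_X:
  fixes \<phi> :: "(real ^ 'd) \<times> (real ^ 'd) \<Rightarrow> real"
  assumes \<phi>: "continuous_on UNIV \<phi>" and "\<tau> \<le> T" "k \<le> m"
  shows "integrable M (\<lambda>\<omega>. \<phi> (X \<tau> k \<omega>, X \<tau> 0 \<omega>))"
proof -
  obtain C1 where C1: "\<And>\<omega>. \<omega> \<in> space M \<Longrightarrow> norm (X \<tau> k \<omega>) \<le> C1"
    using X_bounded[OF assms(2,3)] by blast
  obtain C2 where C2: "\<And>\<omega>. \<omega> \<in> space M \<Longrightarrow> norm (X \<tau> 0 \<omega>) \<le> C2"
    using X_bounded[OF assms(2) le0] by blast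
  have "compact (\<phi> ` (cball 0 C1 \<times> cball 0 C2))"
    by (intro compact_continuous_image continuous_on_subset[OF \<phi>] compact_Times) auto
  then obtain C where C: "\<And>w. w \<in> cball 0 C1 \<times> cball 0 C2 \<Longrightarrow> norm (\<phi> w) \<le> C"
    unfolding compact_eq_bounded_closed bounded_iff by (meson imageI)
  show ?thesis
  proof (rule integrable_const_bound[where B=C])
    show "AE \<omega> in M. norm (\<phi> (X \<tau> k \<omega>, X \<tau> 0 \<omega>)) \<le> C"
      using C1 C2 by (intro AE_I2 C) auto
    show "(\<lambda>\<omega>. \<phi> (X \<tau> k \<omega>, X \<tau> 0 \<omega>)) \<in> borel_measurable M"
      using random_X[OF assms(2)] assms(3)
      by (intro measurable_compose[OF _ borel_measurable_continuous_onI[OF \<phi>]] borel_measurable_Pair) auto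
  qed
qed

lemma indep_others:
  assumes p: "p \<in> draws"
  shows "indep_pair (PiM (draws - {p}) (\<lambda>_. draw_space n)) (\<lambda>\<omega>. restrict (\<lambda>q. Z q \<omega>) (draws - {p}))
    (draw_space n) (Z p)"
proof -
  have "indep_var (PiM (draws - {p}) (\<lambda>_. draw_space n)) (\<lambda>\<omega>. restrict (\<lambda>q. Z q \<omega>) (draws - {p}))
      (PiM {p} (\<lambda>_. draw_space n)) (\<lambda>\<omega>. restrict (\<lambda>q. Z q \<omega>) {p})"
    using p by (intro indep_var_restrict[OF indep]) auto
  then have "indep_pair (PiM (draws - {p}) (\<lambda>_. draw_space n)) (\<lambda>\<omega>. restrict (\<lambda>q. Z q \<omega>) (draws - {p}))
      (PiM {p} (\<lambda>_. draw_space n)) (\<lambda>\<omega>. restrict (\<lambda>q. Z q \<omega>) {p})"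
    unfolding indep_var_distribution_eq indep_pair_def .
  from indep_pair_compose[OF this measurable_ident measurable_component_singleton, of p]
  show ?thesis by simp
qed

text \<open>The current iterate and its anchor are functions of earlier draws. Adding a second
  draw of the current batch to them still leaves a function of draws other than the one at
  position \<open>j\<close>.\<close>

lemma indep_state:
  assumes "\<tau> \<le> T" "k < m" "j \<in> {1..b}"
  shows "indep_pair (borel \<Otimes>\<^sub>M borel) (\<lambda>\<omega>. (X \<tau> k \<omega>, X \<tau> 0 \<omega>)) (draw_space n) (Z (\<tau>, k, j))"
    and "i \<in> {1..b} \<Longrightarrow> i \<noteq> j \<Longrightarrow>
      indep_pair ((borel \<Otimes>\<^sub>M borel) \<Otimes>\<^sub>M draw_space n)
        (\<lambda>\<omega>. ((X \<tau> k \<omega>, X \<tau> 0 \<omega>), Z (\<tau>, k, i) \<omega>)) (draw_space n) (Z (\<tau>, k, j))"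
proof -
  let ?B = "draws - {(\<tau>, k, j)}"
  have p: "(\<tau>, k, j) \<in> draws" using assms by auto
  have past: "past \<tau> k \<subseteq> ?B" "past \<tau> 0 \<subseteq> ?B"
    using assms by (auto simp: past_def)
  have state: "(\<lambda>z. (run z \<tau> k, run z \<tau> 0)) \<in> PiM ?B (\<lambda>_. draw_space n) \<rightarrow>\<^sub>M borel \<Otimes>\<^sub>M borel"
    by (intro measurable_Pair measurable_run past)
  show "indep_pair (borel \<Otimes>\<^sub>M borel) (\<lambda>\<omega>. (X \<tau> k \<omega>, X \<tau> 0 \<omega>)) (draw_space n) (Z (\<tau>, k, j))"
    using indep_pair_compose[OF indep_others[OF p] state measurable_ident]
    by (simp only: X_restrict[OF past(1)] X_restrict[OF past(2)] id_apply)
  assume i: "i \<in> {1..b}" "i \<noteq> j"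
  then have q: "(\<tau>, k, i) \<in> ?B" using assms by auto
  have "(\<lambda>z. ((run z \<tau> k, run z \<tau> 0), z (\<tau>, k, i)))
      \<in> PiM ?B (\<lambda>_. draw_space n) \<rightarrow>\<^sub>M (borel \<Otimes>\<^sub>M borel) \<Otimes>\<^sub>M draw_space n"
    by (intro measurable_Pair state measurable_component_singleton q)
  from indep_pair_compose[OF indep_others[OF p] this measurable_ident]
  show "indep_pair ((borel \<Otimes>\<^sub>M borel) \<Otimes>\<^sub>M draw_space n)
      (\<lambda>\<omega>. ((X \<tau> k \<omega>, X \<tau> 0 \<omega>), Z (\<tau>, k, i) \<omega>)) (draw_space n) (Z (\<tau>, k, j))"
    by (simp only: X_restrict[OF past(1)] X_restrict[OF past(2)] restrict_apply'[OF q] id_apply)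
qed

abbreviation "drift \<tau> k \<omega> \<equiv> (norm (X \<tau> k \<omega> - X \<tau> 0 \<omega>))\<^sup>2"

abbreviation "noise \<tau> k \<omega> \<equiv> (norm (mean_fluctuation (\<lambda>p. Z p \<omega>) \<tau> k))\<^sup>2"

lemma integrable_drift:
  assumes "\<tau> \<le> T" "k \<le> m"
  shows "integrable M (drift \<tau> k)"
proof -
  have "continuous_on UNIV (\<lambda>w :: (real ^ 'd) \<times> (real ^ 'd). (norm (fst w - snd w))\<^sup>2)"
    by (intro continuous_on_power continuous_on_norm continuous_on_diff continuous_on_fst
        continuous_on_snd continuous_on_id)
  from integrable_continuous_X[OF this assms] show ?thesis by simp
qed

lemma expectation_noise_le:
  assumes "\<tau> \<le> T" "k < m"
  shows "integrable M (noise \<tau> k)"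
    and "expectation (noise \<tau> k) \<le> real CARD('d) * L\<^sup>2 / (real l * real b) * expectation (drift \<tau> k)"
proof -
  define V where "V w = real CARD('d) * L\<^sup>2 / real l * (norm (fst w - snd w))\<^sup>2" for w :: "(real ^ 'd) \<times> (real ^ 'd)"
  define S where "S \<omega> = (norm (\<Sum>j = 1..b. fluctuation enum l n fs (Z (\<tau>, k, j) \<omega>) (X \<tau> k \<omega>, X \<tau> 0 \<omega>)))\<^sup>2" for \<omega>
  have p: "(\<tau>, k, j) \<in> draws" if "j \<in> {1..b}" for j using assms that by auto
  obtain C1 where C1: "\<And>\<omega>. \<omega> \<in> space M \<Longrightarrow> norm (X \<tau> k \<omega>) \<le> C1"
    using X_bounded[OF assms(1) less_imp_le[OF assms(2)]] by blast
  obtain C2 where C2: "\<And>\<omega>. \<omega> \<in> space M \<Longrightarrow> norm (X \<tau> 0 \<omega>) \<le> C2"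
    using X_bounded[OF assms(1) le0] by blast
  have bounded: "norm (fluctuation enum l n fs (Z (\<tau>, k, j) \<omega>) (X \<tau> k \<omega>, X \<tau> 0 \<omega>))
      \<le> (real CARD('d) / real l + 1) * (L * (C1 + C2))" if "j \<in> {1..b}" "\<omega> \<in> space M" for j \<omega>
  proof (rule order_trans[OF fluctuation_le[OF draw_in_space[OF p[OF that(1)] that(2)]]])
    have "norm (X \<tau> k \<omega> - X \<tau> 0 \<omega>) \<le> C1 + C2"
      using C1[OF that(2)] C2[OF that(2)] norm_triangle_ineq4[of "X \<tau> k \<omega>" "X \<tau> 0 \<omega>"] by linarith
    then show "(real CARD('d) / real l + 1) * (L * norm (X \<tau> k \<omega> - X \<tau> 0 \<omega>))
        \<le> (real CARD('d) / real l + 1) * (L * (C1 + C2))"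
      using L by (intro mult_left_mono) auto
  qed
  have V: "integrable M (\<lambda>\<omega>. V (X \<tau> k \<omega>, X \<tau> 0 \<omega>))"
    using integrable_drift[OF assms(1) less_imp_le[OF assms(2)]] by (simp add: V_def)
  have centred: "(\<integral>y. inner u (fluctuation enum l n fs y w) \<partial>distr M (draw_space n) (Z (\<tau>, k, j))) = 0"
    if "j \<in> {1..b}" for j w u
    unfolding law[OF p[OF that]] by (rule integral_fluctuation)
  have var: "(\<integral>y. (norm (fluctuation enum l n fs y w))\<^sup>2 \<partial>distr M (draw_space n) (Z (\<tau>, k, j))) \<le> V w"
    if "j \<in> {1..b}" for j w
    unfolding law[OF p[OF that]] V_def by (rule integral_norm_fluctuation_le)
  note sum = expectation_norm_sum_centred_le[where J="{1..b}" and Z="\<lambda>j. Z (\<tau>, k, j)"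
      and W="\<lambda>\<omega>. (X \<tau> k \<omega>, X \<tau> 0 \<omega>)" and \<psi>="fluctuation enum l n fs" and V=V,
      OF finite_atLeastAtMost indep_state(1)[OF assms] indep_state(2)[OF assms]
        measurable_fluctuation bounded centred var V, folded S_def]
  have S: "integrable M S" "expectation S \<le> real b * expectation (\<lambda>\<omega>. V (X \<tau> k \<omega>, X \<tau> 0 \<omega>))"
    using sum by simp_all
  have eq: "noise \<tau> k \<omega> = 1 / (real b)\<^sup>2 * S \<omega>" for \<omega>
    by (simp add: mean_fluctuation_def S_def X_def power_divide)
  show "integrable M (noise \<tau> k)" unfolding eq using S(1) by simp
  have "expectation (noise \<tau> k) = 1 / (real b)\<^sup>2 * expectation S" unfolding eq by simp
  also have "\<dots> \<le> 1 / (real b)\<^sup>2 * (real b * expectation (\<lambda>\<omega>. V (X \<tau> k \<omega>, X \<tau> 0 \<omega>)))"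
    using S(2) by (intro mult_left_mono) auto
  also have "\<dots> = real CARD('d) * L\<^sup>2 / (real l * real b) * expectation (drift \<tau> k)"
    using b l by (simp add: V_def power2_eq_square)
  finally show "expectation (noise \<tau> k)
      \<le> real CARD('d) * L\<^sup>2 / (real l * real b) * expectation (drift \<tau> k)" .
qed

lemma continuous_gradient_mapping: "continuous_on UNIV (gradient_mapping \<gamma> f h)"
  unfolding gradient_mapping_def[abs_def]
  by (intro continuous_intros continuous_on_compose2[OF continuous_prox[OF convex proximable \<gamma>]]
      smooth_with_continuous(2)[OF smooth_f]) auto

text \<open>Only the fluctuations and the distances to the anchor are integrated: the potential enters the
  trajectory bound through its value at the deterministic starting point and its lower bound.\<close>

lemma expectation_gradient_mapping_le:
  assumes h00: "\<bar>h x00\<bar> \<noteq> \<infinity>"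
    and step: "L * \<gamma> \<le> 1 / 4" "32 * \<gamma>\<^sup>2 * L\<^sup>2 * (real m)\<^sup>2 * real CARD('d) \<le> real l * real b"
    and lower: "\<And>x. \<bar>h x\<bar> \<noteq> \<infinity> \<Longrightarrow> F \<le> potential x"
  shows "\<gamma> / 2 * (\<Sum>\<tau> = 0..T. \<Sum>k<m. expectation (\<lambda>\<omega>. (norm (gradient_mapping \<gamma> f h (X \<tau> k \<omega>)))\<^sup>2))
      \<le> potential x00 - F
        + \<gamma> / 2 * real m * ((4 * (real CARD('d))\<^sup>2 + real CARD('d)) * L\<^sup>2) * (\<Sum>\<tau> = 0..T. (\<beta> \<tau>)\<^sup>2)"
proof -
  define c where "c = real CARD('d) * L\<^sup>2 / (real l * real b)"
  define K where "K = potential x00 - F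
        + \<gamma> / 2 * real m * ((4 * (real CARD('d))\<^sup>2 + real CARD('d)) * L\<^sup>2) * (\<Sum>\<tau> = 0..T. (\<beta> \<tau>)\<^sup>2)"
  define G where "G \<tau> k \<omega> = (norm (gradient_mapping \<gamma> f h (X \<tau> k \<omega>)))\<^sup>2" for \<tau> k \<omega>
  have cont: "continuous_on UNIV (\<lambda>w :: (real ^ 'd) \<times> (real ^ 'd). (norm (gradient_mapping \<gamma> f h (fst w)))\<^sup>2)"
    by (intro continuous_on_power continuous_on_norm
        continuous_on_compose2[OF continuous_gradient_mapping] continuous_on_fst continuous_on_id) auto
  have G: "integrable M (G \<tau> k)" if "\<tau> \<in> {0..T}" "k \<in> {..<m}" for \<tau> k
    using integrable_continuous_X[OF cont, of \<tau> k] that by (simp add: G_def[abs_def])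
  have excess: "integrable M (\<lambda>\<omega>. noise \<tau> k \<omega> - c * drift \<tau> k \<omega>)"
    "expectation (\<lambda>\<omega>. noise \<tau> k \<omega> - c * drift \<tau> k \<omega>) \<le> 0" if "\<tau> \<in> {0..T}" "k \<in> {..<m}" for \<tau> k
    using expectation_noise_le[of \<tau> k] integrable_drift[of \<tau> k] that by (simp_all add: c_def)
  have gradient_sum: "integrable M (\<lambda>\<omega>. \<Sum>\<tau> = 0..T. \<Sum>k<m. G \<tau> k \<omega>)"
    "expectation (\<lambda>\<omega>. \<Sum>\<tau> = 0..T. \<Sum>k<m. G \<tau> k \<omega>) = (\<Sum>\<tau> = 0..T. \<Sum>k<m. expectation (G \<tau> k))"
    by (rule expectation_double_sum, rule G, assumption+)+
  have excess_sum: "integrable M (\<lambda>\<omega>. \<Sum>\<tau> = 0..T. \<Sum>k<m. noise \<tau> k \<omega> - c * drift \<tau> k \<omega>)"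
    "expectation (\<lambda>\<omega>. \<Sum>\<tau> = 0..T. \<Sum>k<m. noise \<tau> k \<omega> - c * drift \<tau> k \<omega>)
      = (\<Sum>\<tau> = 0..T. \<Sum>k<m. expectation (\<lambda>\<omega>. noise \<tau> k \<omega> - c * drift \<tau> k \<omega>))"
    by (rule expectation_double_sum, rule excess(1), assumption+)+
  have nonpos: "(\<Sum>\<tau> = 0..T. \<Sum>k<m. expectation (\<lambda>\<omega>. noise \<tau> k \<omega> - c * drift \<tau> k \<omega>)) \<le> 0"
    by (intro sum_nonpos excess(2))
  have "\<gamma> / 2 * (\<Sum>\<tau> = 0..T. \<Sum>k<m. expectation (G \<tau> k))
      = expectation (\<lambda>\<omega>. \<gamma> / 2 * (\<Sum>\<tau> = 0..T. \<Sum>k<m. G \<tau> k \<omega>))"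
    using gradient_sum by simp
  also have "\<dots> \<le> expectation (\<lambda>\<omega>. K + \<gamma> * (\<Sum>\<tau> = 0..T. \<Sum>k<m. noise \<tau> k \<omega> - c * drift \<tau> k \<omega>))"
  proof (rule integral_mono)
    fix \<omega> assume "\<omega> \<in> space M"
    then have "\<And>p. p \<in> draws \<Longrightarrow> Z p \<omega> \<in> space (draw_space n)" by (rule draw_in_space[rotated])
    from trajectory_descent[where z="\<lambda>p. Z p \<omega>" and T=T, OF h00 this step lower]
    show "\<gamma> / 2 * (\<Sum>\<tau> = 0..T. \<Sum>k<m. G \<tau> k \<omega>)
        \<le> K + \<gamma> * (\<Sum>\<tau> = 0..T. \<Sum>k<m. noise \<tau> k \<omega> - c * drift \<tau> k \<omega>)"
      unfolding K_def G_def c_def X_def sum_distrib_left by simp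
  next
    show "integrable M (\<lambda>\<omega>. \<gamma> / 2 * (\<Sum>\<tau> = 0..T. \<Sum>k<m. G \<tau> k \<omega>))"
      by (rule integrable_mult_right[OF gradient_sum(1)])
    show "integrable M (\<lambda>\<omega>. K + \<gamma> * (\<Sum>\<tau> = 0..T. \<Sum>k<m. noise \<tau> k \<omega> - c * drift \<tau> k \<omega>))"
      by (rule Bochner_Integration.integrable_add[OF integrable_const integrable_mult_right[OF excess_sum(1)]])
  qed
  also have "\<dots> = K + \<gamma> * (\<Sum>\<tau> = 0..T. \<Sum>k<m. expectation (\<lambda>\<omega>. noise \<tau> k \<omega> - c * drift \<tau> k \<omega>))"
    unfolding Bochner_Integration.integral_add[OF integrable_const integrable_mult_right[OF excess_sum(1)]]
      integral_mult_right_zero excess_sum(2)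
    by (simp add: prob_space)
  also have "\<dots> \<le> K"
    using mult_nonneg_nonpos[OF less_imp_le[OF \<gamma>] nonpos] by simp
  finally show ?thesis unfolding K_def G_def .
qed

end

section \<open>The convergence rate\<close>

theorem theorem1:
  fixes n T m l b :: nat
    and enum :: "nat \<Rightarrow> 'd::finite"
    and fs :: "nat \<Rightarrow> real ^ 'd \<Rightarrow> real"
    and h :: "real ^ 'd \<Rightarrow> ereal"
    and L \<gamma> \<Delta> :: real
    and \<beta> :: "nat \<Rightarrow> real"
    and x00 :: "real ^ 'd"
    and M :: "'w measure"
    and \<mu> :: "(real ^ 'd ^ 'd) measure"
    and idx :: "nat \<Rightarrow> nat \<Rightarrow> nat \<Rightarrow> 'w \<Rightarrow> nat"
    and rot :: "nat \<Rightarrow> nat \<Rightarrow> nat \<Rightarrow> 'w \<Rightarrow> real ^ 'd ^ 'd"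
    and X :: "nat \<Rightarrow> nat \<Rightarrow> 'w \<Rightarrow> real ^ 'd"
  assumes enum: "bij_betw enum {1..CARD('d)} UNIV"
    and n: "n \<ge> 1"
    and f_diff: "\<forall>i\<in>{1..n}. \<forall>x. fs i differentiable (at x)"
    and L: "L > 0"
    and f_smooth: "\<forall>i\<in>{1..n}. \<forall>x y.
          norm (gradient (fs i) x - gradient (fs i) y) \<le> L * norm (x - y)"
    and h_convex: "convex_ext h"
    and h_prox: "proximable h"
    and min_exists: "\<exists>x. is_arg_min (objective n fs h) (\<lambda>_. True) x"
    and T: "T \<ge> 1"
    and m: "m > 1"
    and l: "1 \<le> l" "l \<le> CARD('d)"
    and b: "b \<ge> 1"
    and \<beta>: "\<forall>\<tau>. \<beta> \<tau> > 0"
    and \<gamma>_pos: "0 < \<gamma>"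
    and \<gamma>_less: "\<gamma> < min (1 / (4 * L))
          (sqrt (real l * real b) / (sqrt (32 * (exp 1 - 1) * real CARD('d)) * L * real m))"
    and \<Delta>: "\<Delta> = 1 / 2 - L * \<gamma>"
    and prob: "prob_space M"
    and haar: "is_normalized_haar \<mu>"
    and sampling: "vr_szd_sampling M n \<mu> T m b idx rot"
    and X: "\<forall>\<tau> k \<omega>. X \<tau> k \<omega> =
          vr_szd enum n fs h l b m \<gamma> \<beta> x00
            (\<lambda>\<tau> k j. idx \<tau> k j \<omega>) (\<lambda>\<tau> k j. rot \<tau> k j \<omega>) \<tau> k"
  shows "ereal (convergence_measure M \<gamma> (finite_sum n fs) h X T m) \<le>
      (objective n fs h x00 - (INF x. objective n fs h x)) / ereal (\<Delta> * \<gamma> * real m * real (T + 1))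
      + ereal ((3 * real CARD('d) / (real l * real b) + 2 + 3 * real CARD('d))
               * (L\<^sup>2 * real CARD('d) / (\<Delta> * real (T + 1)))
               * (\<Sum>\<tau> = 0..T. (\<beta> \<tau>)\<^sup>2))"
proof -
  let ?d = "real CARD('d)"
  let ?f = "finite_sum n fs"
  have smooth: "smooth_with L (fs i)" if "i \<in> {1..n}" for i
    using f_diff f_smooth that by (simp add: smooth_with_def)
  interpret M: prob_space M by (rule prob)
  have haar: "haar_orthogonal \<mu>" by unfold_locales (rule haar)
  define Z where "Z = (\<lambda>(\<tau>, k, j) \<omega>. (idx \<tau> k j \<omega>, rot \<tau> k j \<omega>))"
  interpret P: vr_szd_process n l b m enum fs h L \<gamma> \<beta> x00 \<mu> M T Z
  proof (intro vr_szd_process.intro vr_szd_draws.intro vr_szd_setting.intro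
      vr_szd_process_axioms.intro haar prob smooth)
    show "M.indep_vars (\<lambda>_. draw_space n) Z ({0..T} \<times> {0..<m} \<times> {1..b})"
      using sampling unfolding vr_szd_sampling_def Z_def by blast
    show "distr M (draw_space n) (Z p) = uniform_count_measure {1..n} \<Otimes>\<^sub>M \<mu>"
      if "p \<in> {0..T} \<times> {0..<m} \<times> {1..b}" for p
      using sampling that unfolding vr_szd_sampling_def Z_def by force
  qed (use enum n l b h_convex h_prox L \<gamma>_pos \<beta> in auto)
  have X_eq: "X = P.X"
  proof -
    have "fst (Z (\<tau>, k, j) \<omega>) = idx \<tau> k j \<omega>" "snd (Z (\<tau>, k, j) \<omega>) = rot \<tau> k j \<omega>" for \<tau> k j \<omega>
      by (simp_all add: Z_def)
    then show ?thesis by (intro ext) (simp add: X P.X_def P.run_def)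
  qed

  have step1: "L * \<gamma> \<le> 1 / 4" and \<Delta>_bounds: "0 < \<Delta>" "\<Delta> \<le> 1 / 2"
  proof -
    have "\<gamma> < 1 / (4 * L)" using \<gamma>_less by simp
    then have "L * \<gamma> < 1 / 4" using L by (simp add: field_simps)
    moreover have "0 < L * \<gamma>" using L \<gamma>_pos by simp
    ultimately show "L * \<gamma> \<le> 1 / 4" "0 < \<Delta>" "\<Delta> \<le> 1 / 2" by (simp_all add: \<Delta>)
  qed
  (* The second bound on the stepsize, squared and simplified by e - 1 >= 1. *)
  have step2: "32 * \<gamma>\<^sup>2 * L\<^sup>2 * (real m)\<^sup>2 * ?d \<le> real l * real b"
  proof -
    have e: "exp 1 - 1 \<ge> (1 :: real)" using exp_ge_add_one_self[of 1] by simp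
    define s where "s = sqrt (32 * (exp 1 - 1) * ?d)"
    have s: "s > 0" using e by (simp add: s_def)
    have "\<gamma> < sqrt (real l * real b) / (s * L * real m)" using \<gamma>_less by (simp add: s_def)
    then have "\<gamma> * (s * L * real m) \<le> sqrt (real l * real b)"
      using s L m by (simp add: pos_less_divide_eq)
    then have "(\<gamma> * (s * L * real m))\<^sup>2 \<le> (sqrt (real l * real b))\<^sup>2"
      using s L \<gamma>_pos by (intro power_mono) auto
    then have "s\<^sup>2 * (\<gamma>\<^sup>2 * L\<^sup>2 * (real m)\<^sup>2) \<le> real l * real b"
      by (simp add: power_mult_distrib mult_ac)
    moreover have "32 * ?d * (\<gamma>\<^sup>2 * L\<^sup>2 * (real m)\<^sup>2) \<le> s\<^sup>2 * (\<gamma>\<^sup>2 * L\<^sup>2 * (real m)\<^sup>2)"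
    proof (rule mult_right_mono)
      have "32 * ?d * 1 \<le> 32 * ?d * (exp 1 - 1)" using e by (intro mult_left_mono) auto
      then show "32 * ?d \<le> s\<^sup>2" using e by (simp add: s_def mult_ac)
    qed simp
    ultimately show ?thesis by (simp add: mult_ac)
  qed

  obtain xm where xm: "\<And>x. objective n fs h xm \<le> objective n fs h x"
    using min_exists by (auto simp: is_arg_min_linorder)
  then have INF: "(INF x. objective n fs h x) = objective n fs h xm"
    by (intro antisym INF_lower INF_greatest) auto
  obtain z0 where "h z0 \<noteq> \<infinity>" using proximable_proper[OF h_convex h_prox] by blast
  then have "h xm \<noteq> \<infinity>" using xm[of z0] by (auto simp: objective_def)
  moreover have h_MInf: "h x \<noteq> -\<infinity>" for x using h_convex by (simp add: convex_ext_def)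
  ultimately have xm_fin: "\<bar>h xm\<bar> \<noteq> \<infinity>" by auto
  have objective_potential: "objective n fs h x = ereal (P.potential x)" if "\<bar>h x\<bar> \<noteq> \<infinity>" for x
    using that by (cases "h x") (auto simp: objective_def P.potential_def)
  define C where "C = (3 * ?d / (real l * real b) + 2 + 3 * ?d) * (L\<^sup>2 * ?d / (\<Delta> * real (T + 1)))
               * (\<Sum>\<tau> = 0..T. (\<beta> \<tau>)\<^sup>2)"
  have scale: "\<Delta> * \<gamma> * real m * real (T + 1) > 0" using \<Delta>_bounds \<gamma>_pos m by simp
  show ?thesis
  proof (cases "h x00 = \<infinity>")
    case True
    (* An infeasible starting point makes the right-hand side infinite. *)
    then have "objective n fs h x00 - (INF x. objective n fs h x) = \<infinity>"
      unfolding INF objective_potential[OF xm_fin] by (simp add: objective_def)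
    moreover have "\<infinity> / ereal (\<Delta> * \<gamma> * real m * real (T + 1)) = \<infinity>"
      using less_imp_le[OF scale] unfolding ereal_divide_ereal by (rule if_P)
    ultimately show ?thesis by (simp only:) simp
  next
    case False
    then have h00: "\<bar>h x00\<bar> \<noteq> \<infinity>" using h_MInf by auto
    define F where "F = P.potential xm"
    define S where "S = (\<Sum>\<tau> = 0..T. (\<beta> \<tau>)\<^sup>2)"
    define E where "E = (\<Sum>\<tau> = 0..T. \<Sum>k<m. M.expectation (\<lambda>\<omega>. (norm (gradient_mapping \<gamma> ?f h (P.X \<tau> k \<omega>)))\<^sup>2))"
    have lower: "F \<le> P.potential x" if "\<bar>h x\<bar> \<noteq> \<infinity>" for x
      using xm[of x] unfolding F_def objective_potential[OF that] objective_potential[OF xm_fin] by simp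
    have main: "\<gamma> / 2 * E \<le> P.potential x00 - F + \<gamma> / 2 * real m * ((4 * ?d\<^sup>2 + ?d) * L\<^sup>2) * S"
      unfolding E_def S_def by (rule P.expectation_gradient_mapping_le[OF h00 step1 step2 lower])
    have "convergence_measure M \<gamma> ?f h X T m \<le> (P.potential x00 - F) / (\<Delta> * \<gamma> * real m * real (T + 1)) + C"
    proof -
      define D where "D = (4 * ?d\<^sup>2 + ?d) * L\<^sup>2"
      (* The summed bound has the constants 2 and 4 d^2 + d; they compare with the claimed ones
         because 1 / \<Delta> >= 2. *)
      define K where "K = 3 * ?d / (real l * real b) + 2 + 3 * ?d"
      have "S \<ge> 0" by (simp add: S_def sum_nonneg)
      have gap: "P.potential x00 - F \<ge> 0" using lower[OF h00] by simp
      have inv\<Delta>: "2 \<le> 1 / \<Delta>" using \<Delta>_bounds by (simp add: field_simps)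
      have rearrange: "(2 / \<gamma> * A + M' * D' * S') / (N * M') = 2 * (A / (\<gamma> * M' * N)) + D' * S' / N"
        if "N > 0" "M' > 0" for A M' D' S' N :: real
        using that \<gamma>_pos by (simp add: field_simps)
      have "E \<le> 2 / \<gamma> * (P.potential x00 - F) + real m * D * S"
        using main \<gamma>_pos unfolding D_def[symmetric] by (simp add: field_simps)
      then have "E / (real (T + 1) * real m)
          \<le> (2 / \<gamma> * (P.potential x00 - F) + real m * D * S) / (real (T + 1) * real m)"
        by (rule divide_right_mono) simp
      also have "\<dots> = 2 * ((P.potential x00 - F) / (\<gamma> * real m * real (T + 1))) + D * S / real (T + 1)"
        by (rule rearrange) (use m in auto)
      also have "\<dots> \<le> 1 / \<Delta> * ((P.potential x00 - F) / (\<gamma> * real m * real (T + 1)))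
          + K * (L\<^sup>2 * ?d / \<Delta>) * S / real (T + 1)"
      proof (intro add_mono mult_right_mono divide_right_mono inv\<Delta>)
        have "K \<ge> 2 + 3 * ?d" by (simp add: K_def)
        then have "2 * (2 + 3 * ?d) \<le> 1 / \<Delta> * K" using inv\<Delta> \<Delta>_bounds by (intro mult_mono) auto
        then have "?d * L\<^sup>2 * (4 * ?d + 1) \<le> ?d * L\<^sup>2 * (1 / \<Delta> * K)"
          by (intro mult_left_mono) auto
        then show "D \<le> K * (L\<^sup>2 * ?d / \<Delta>)"
          by (simp add: D_def power2_eq_square algebra_simps)
      qed (use gap \<gamma>_pos \<open>S \<ge> 0\<close> in auto)
      also have "\<dots> = (P.potential x00 - F) / (\<Delta> * \<gamma> * real m * real (T + 1)) + C"
        using \<Delta>_bounds by (simp add: C_def K_def S_def mult_ac)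
      finally show ?thesis
        by (simp add: convergence_measure_def E_def X_eq atLeast0LessThan)
    qed
    moreover have "ereal a / ereal (\<Delta> * \<gamma> * real m * real (T + 1))
        = ereal (a / (\<Delta> * \<gamma> * real m * real (T + 1)))" for a
      by (rule trans[OF ereal_divide if_not_P]) (use scale in linarith)
    ultimately show ?thesis
      unfolding INF objective_potential[OF xm_fin] objective_potential[OF h00] C_def[symmetric] F_def
      by (simp only: ereal_minus(1) plus_ereal.simps(1) ereal_less_eq(3))
  qed
qed

end
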